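(* Let $G'$ be a non-trivial nilpotent group of odd order having no Sylow subgroup which is cyclic. If $G\cong G'\times\mathbb{Z}_n$, where $n\geq 1$ and $\gcd(n,|G'|)=1$, then $\lambda(\mathcal{P}_E(G))=|G|+|\mathrm{Dom}(\mathcal{P}_E(G))|-1$.
   Context: The enhanced power graph $\mathcal{P}_E(G)$ of a finite group $G$ is the simple undirected graph with vertex set $G$ in which two distinct vertices $x,y$ are adjacent if there is $z\in G$ with $x,y\in\langle z\rangle$. $\mathrm{Dom}(\Gamma)$ is the set of dominating vertices of a graph $\Gamma$, i.e. vertices adjacent to all other vertices. $\mathbb{Z}_n$ is the cyclic group of order $n$. "No Sylow subgroup which is cyclic" means that for every prime $p$ dividing $|G'|$ the Sylow $p$-subgroup of $G'$ is non-cyclic. An $L(2,1)$-labeling of a finite graph $\Gamma$ is an integer-valued function $f$ on $V(\Gamma)$ such that $|f(u)-f(v)|\geq 2$ whenever $u,v$ are adjacent and $|f(u)-f(v)|\geq 1$ whenever $u,v$ are at distance $2$. Its span is the difference between the maximum and the minimum of $f$. The $\lambda$-number $\lambda(\Gamma)$ is the minimum span over all $L(2,1)$-labelings of $\Gamma$. *)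

theory Defs
  imports
    "HOL-Algebra.Elementary_Groups"
    "HOL-Algebra.Sylow"
    "HOL-Computational_Algebra.Primes"
    "Graph_Theory.Graph_Theory"
begin

fun lower_central :: "('a, 'm) monoid_scheme \<Rightarrow> nat \<Rightarrow> 'a set" where
  "lower_central G 0 = carrier G"
| "lower_central G (Suc i) =
     generate G {h \<otimes>\<^bsub>G\<^esub> g \<otimes>\<^bsub>G\<^esub> inv\<^bsub>G\<^esub> h \<otimes>\<^bsub>G\<^esub> inv\<^bsub>G\<^esub> g | h g. h \<in> lower_central G i \<and> g \<in> carrier G}"

definition nilpotent_group :: "('a, 'm) monoid_scheme \<Rightarrow> bool" where
  "nilpotent_group G \<longleftrightarrow> group G \<and> (\<exists>c. lower_central G c = {\<one>\<^bsub>G\<^esub>})"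

definition sylow_subgroup :: "('a, 'm) monoid_scheme \<Rightarrow> nat \<Rightarrow> 'a set \<Rightarrow> bool" where
  "sylow_subgroup G p P \<longleftrightarrow> subgroup P G \<and> card P = p ^ multiplicity p (order G)"

text \<open>
  Simple undirected graphs are symmetric loop-free \<^typ>\<open>'a pair_pre_digraph\<close>s, each edge being
  represented by both of its orientations (cf. the locale \<^locale>\<open>pair_graph\<close>).
\<close>

definition enhanced_power_graph :: "('a, 'm) monoid_scheme \<Rightarrow> 'a pair_pre_digraph" where
  "enhanced_power_graph G =
     \<lparr> pverts = carrier G,
       parcs = {(x, y). x \<in> carrier G \<and> y \<in> carrier G \<and> x \<noteq> y \<and>
                  (\<exists>z \<in> carrier G. x \<in> generate G {z} \<and> y \<in> generate G {z})} \<rparr>"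

lemma pair_graph_enhanced_power_graph:
  "finite (carrier G) \<Longrightarrow> pair_graph (enhanced_power_graph G)"
proof (unfold_locales, goal_cases)
  case 4
  have "parcs (enhanced_power_graph G) \<subseteq> carrier G \<times> carrier G"
    by (auto simp: enhanced_power_graph_def)
  with 4 show ?case by (meson finite_SigmaI finite_subset)
qed (auto simp: enhanced_power_graph_def arcs_ends_def arc_to_ends_def symmetric_def sym_def)

definition dominating_vertices :: "'a pair_pre_digraph \<Rightarrow> 'a set" where
  "dominating_vertices \<Gamma> = {x \<in> pverts \<Gamma>. \<forall>y \<in> pverts \<Gamma>. y \<noteq> x \<longrightarrow> (x, y) \<in> parcs \<Gamma>}"

text \<open>Shortest-path length with unit weights; it is infinite between different components.\<close>

definition graph_dist :: "'a pair_pre_digraph \<Rightarrow> 'a \<Rightarrow> 'a \<Rightarrow> ereal" where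
  "graph_dist \<Gamma> u v = wf_digraph.\<mu> (with_proj \<Gamma>) (\<lambda>_. 1) u v"

text \<open>Labelings are total functions; only their values on the vertices are relevant.\<close>

definition L21_labeling :: "'a pair_pre_digraph \<Rightarrow> ('a \<Rightarrow> int) \<Rightarrow> bool" where
  "L21_labeling \<Gamma> f \<longleftrightarrow>
     (\<forall>u \<in> pverts \<Gamma>. \<forall>v \<in> pverts \<Gamma>.
        ((u, v) \<in> parcs \<Gamma> \<longrightarrow> \<bar>f u - f v\<bar> \<ge> 2) \<and>
        (graph_dist \<Gamma> u v = 2 \<longrightarrow> \<bar>f u - f v\<bar> \<ge> 1))"

definition labeling_span :: "'a pair_pre_digraph \<Rightarrow> ('a \<Rightarrow> int) \<Rightarrow> int" where
  "labeling_span \<Gamma> f = Max (f ` pverts \<Gamma>) - Min (f ` pverts \<Gamma>)"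

definition lambda_number :: "'a pair_pre_digraph \<Rightarrow> nat" where
  "lambda_number \<Gamma> = (LEAST k. \<exists>f. L21_labeling \<Gamma> f \<and> labeling_span \<Gamma> f = int k)"

end

theory Submission
  imports
    Defs
    "HOL-Algebra.Multiplicative_Group"
    "HOL-Number_Theory.Cong"
    "HOL-Number_Theory.Residues"
begin

text \<open>
  Let \<open>\<Gamma>\<close> be the enhanced power graph of \<open>G\<close>, let \<open>D\<close> be its set of dominating vertices and
  \<open>V = carrier G\<close>. As \<open>D\<close> is not empty, two distinct vertices of \<open>\<Gamma>\<close> are adjacent or at distance \<open>2\<close>,
  so every \<open>L(2,1)\<close>-labeling is injective on \<open>V\<close>.

  Lower bound. The label of a dominating vertex differs by at least \<open>2\<close> from all other labels.
  Fix a vertex \<open>v\<close> outside \<open>D\<close>, and for each \<open>d\<close> in \<open>D\<close> add to the set of labels the integer next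
  to the label of \<open>d\<close> on the side of the label of \<open>v\<close>. The added numbers are new, distinct and between the
  minimum and the maximum, hence the span is at least \<open>card V + card D - 1\<close>
  (\<open>L21_labeling_span_ge\<close>).

  Upper bound. If the complement of \<open>\<Gamma>\<close> has a path visiting each vertex of \<open>V - D\<close> exactly once,
  label this path by consecutive integers and then the vertices of \<open>D\<close> by steps of \<open>2\<close>
  (\<open>L21_labeling_of_path\<close>). What remains is to find this path.

  Path. Call two elements cocyclic if they lie in a common cyclic subgroup. In a cyclic group, an
  element \<open>w\<close> whose order divides that of \<open>u\<close> is a power of \<open>u\<close>; therefore \<open>u\<close> and \<open>w\<close> are
  not cocyclic as soon as the order of \<open>w\<close> divides that of \<open>u\<close> and \<open>w\<close> is not a power of \<open>u\<close>
  (\<open>not_cocyclic_if_not_mem_generate\<close>), and for two elements to be non-cocyclic it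
  suffices that their \<open>p\<close>-parts are, for one prime \<open>p\<close>. The primes dividing the order of \<open>G'\<close> are
  added one at a time. When \<open>p\<close> is added, the new elements are sorted by the order \<open>p ^ k\<close> of their
  \<open>p\<close>-part. The elements of one such level, classified by the subgroup that their \<open>p\<close>-part generates,
  fall into classes of equal size, and elements of different classes are not cocyclic;
  since there are at least two classes, a path through the level exists whose first class and last
  element are almost arbitrary (\<open>balanced_multipartite_path\<close>). The levels are visited in decreasing
  order of \<open>k\<close>: the first class of the next level only has to avoid the unique subgroup of order
  \<open>p ^ k\<close> of a given cyclic \<open>p\<close>-group. Finally the path reaches the elements without \<open>p\<close>-part through the
  freely chosen part of its last element that is prime to \<open>p\<close> (\<open>hamiltonian_path\<close>).

  Two cyclic subgroups. That no level consists of a single class is where the hypotheses on \<open>G'\<close>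
  enter: if the Sylow \<open>p\<close>-subgroup \<open>P\<close> of a finite nilpotent group is not cyclic and \<open>p\<close> is odd, then
  each element \<open>x\<close> of order \<open>p ^ k\<close>, \<open>k \<ge> 1\<close>, admits an element of the same order outside
  the subgroup generated by \<open>x\<close> (\<open>odd_noncyclic_second_primary\<close>). Take \<open>y\<close> of maximal order in
  \<open>P\<close> such that \<open>x\<close> is a power of \<open>y\<close>, and \<open>h\<close> in \<open>P\<close>, not a power of \<open>y\<close>, that normalizes the
  subgroup generated by \<open>y\<close> and whose \<open>p\<close>-th power lies in it. As \<open>p\<close> is odd, the \<open>p\<close>-th
  powers of the elements \<open>y ^ j * h\<close> run through all \<open>p\<close>-th powers of powers of \<open>y\<close>, and
  so some \<open>y ^ j * h\<close> has order \<open>p ^ k\<close>.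
\<close>

section \<open>Paths in balanced complete multipartite graphs\<close>

text \<open>The vertices are classified by \<open>c\<close>, all classes having \<open>m\<close> elements. The first class and
  the last vertex of the path are prescribed. Each step of the induction on \<open>m\<close> removes
  a transversal that starts in class \<open>a\<close> and ends in the class of \<open>y\<close>; it contains \<open>y\<close> only
  when \<open>m = 1\<close>.\<close>

lemma balanced_multipartite_path:
  fixes c :: "'a \<Rightarrow> 'c"
  assumes "finite V" and "\<And>i. i \<in> c ` V \<Longrightarrow> card {x \<in> V. c x = i} = m"
    and "a \<in> c ` V" and "y \<in> V" and "c y \<noteq> a"
  shows "\<exists>xs. distinct xs \<and> set xs = V \<and> successively (\<lambda>u v. c u \<noteq> c v) xs \<and>
           xs \<noteq> [] \<and> c (hd xs) = a \<and> last xs = y"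
  using assms
proof (induction m arbitrary: V)
  case 0
  have "card {x \<in> V. c x = c y} = 0"
    using 0(2,4) by blast
  then show ?case
    using 0(1,4) by auto
next
  case (Suc m)
  have "\<exists>t. t \<in> V \<and> c t = i \<and> (m \<noteq> 0 \<longrightarrow> t \<noteq> y) \<and> (m = 0 \<longrightarrow> i = c y \<longrightarrow> t = y)" if i: "i \<in> c ` V" for i
  proof (cases "m = 0")
    case True
    then show ?thesis
      using i Suc.prems(4) by (cases "i = c y") auto
  next
    case False
    have "card ({x \<in> V. c x = i} - {y}) \<ge> m"
      using Suc.prems(2)[OF i] Suc.prems(1) by (metis card_Diff_singleton_if diff_Suc_1 le_refl lessI less_or_eq_imp_le)
    then have "{x \<in> V. c x = i} - {y} \<noteq> {}"
      using False by (metis card.empty not_less_zero le_zero_eq)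
    then show ?thesis
      using False by auto
  qed
  then obtain t where t: "\<And>i. i \<in> c ` V \<Longrightarrow> t i \<in> V \<and> c (t i) = i"
    "\<And>i. i \<in> c ` V \<Longrightarrow> m \<noteq> 0 \<Longrightarrow> t i \<noteq> y" "m = 0 \<Longrightarrow> t (c y) = y"
    using Suc.prems(4) by (metis imageI)
  obtain ms where ms: "distinct ms" "set ms = c ` V - {a, c y}"
    using finite_distinct_list[of "c ` V - {a, c y}"] Suc.prems(1) by auto
  define idx where "idx = a # ms @ [c y]"
  have idx: "distinct idx" "set idx = c ` V" "idx \<noteq> []" "hd idx = a" "last idx = c y"
    using ms Suc.prems by (auto simp: idx_def)
  have inj: "inj_on t (c ` V)"
    using t(1) by (metis inj_on_inverseI)
  \<comment> \<open>The transversal, listed from class \<open>a\<close> to the class of \<open>y\<close>.\<close>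
  define T where "T = map t idx"
  have "successively (\<lambda>i j. i \<noteq> j) idx"
    using idx(1) by (simp add: successively_conv_nth nth_eq_iff_index_eq)
  then have T: "distinct T" "set T = t ` c ` V" "T \<noteq> []" "c (hd T) = a" "c (last T) = c y"
      "successively (\<lambda>u v. c u \<noteq> c v) T"
    unfolding T_def using idx inj t(1) Suc.prems(3,4)
    by (auto simp: distinct_map hd_map last_map successively_map elim: successively_mono)
  show ?case
  proof (cases "m = 0")
    case True
    have "t ` c ` V = V"
    proof -
      have "x = t (c x)" if x: "x \<in> V" for x
      proof -
        have "card {z \<in> V. c z = c x} = 1"
          using Suc.prems(2) x True by auto
        then obtain w where "{z \<in> V. c z = c x} = {w}"
          using card_1_singletonE by blast
        then have "x \<in> {w}" "t (c x) \<in> {w}" using x t(1)[of "c x"] by blast+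
        then show ?thesis by simp
      qed
      then show ?thesis
        using t(1) by force
    qed
    moreover have "last T = y"
      unfolding T_def using idx t(3) True by (simp add: last_map)
    ultimately show ?thesis using T by blast
  next
    case False
    define V' where "V' = V - t ` c ` V"
    have fib: "{x \<in> V'. c x = i} = {x \<in> V. c x = i} - {t i}" if "i \<in> c ` V" for i
      unfolding V'_def using that t(1) by auto
    have cardf: "card {x \<in> V'. c x = i} = m" if "i \<in> c ` V" for i
      using fib[OF that] Suc.prems(1,2) that t(1) by (simp add: card_Diff_singleton_if)
    have cV': "c ` V' = c ` V"
    proof
      show "c ` V' \<subseteq> c ` V" by (auto simp: V'_def)
      show "c ` V \<subseteq> c ` V'"
      proof
        fix i assume "i \<in> c ` V"
        then have "{x \<in> V'. c x = i} \<noteq> {}"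
          using cardf False by (metis card.empty)
        then show "i \<in> c ` V'" by auto
      qed
    qed
    have yV': "y \<in> V'"
      unfolding V'_def using Suc.prems(4) t(2) False by auto
    have "finite V'" by (simp add: V'_def Suc.prems(1))
    from Suc.IH[OF this _ _ yV' Suc.prems(5)] cardf cV' Suc.prems(3)
    obtain xs where xs: "distinct xs" "set xs = V'" "successively (\<lambda>u v. c u \<noteq> c v) xs"
      "xs \<noteq> []" "c (hd xs) = a" "last xs = y" by auto
    have "t ` c ` V \<subseteq> V" using t(1) by auto
    then have "distinct (T @ xs) \<and> set (T @ xs) = V \<and> successively (\<lambda>u v. c u \<noteq> c v) (T @ xs)
      \<and> T @ xs \<noteq> [] \<and> c (hd (T @ xs)) = a \<and> last (T @ xs) = y"
      using T xs Suc.prems(5) by (auto simp: V'_def successively_append_iff)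
    then show ?thesis by blast
  qed
qed

section \<open>Labelings of graphs with a dominating vertex\<close>

lemma graph_dist_self_neq_2:
  assumes "pair_graph \<Gamma>" "u \<in> pverts \<Gamma>"
  shows "graph_dist \<Gamma> u u \<noteq> 2"
proof -
  interpret pair_graph \<Gamma> by fact
  have "awalk u [] u" using assms(2) by (simp add: awalk_Nil_iff)
  from min_cost_le_walk_cost[OF this, of "\<lambda>_. 1"] have "\<mu> (\<lambda>_. 1) u u \<le> 0"
    by (simp add: zero_ereal_def)
  then show ?thesis unfolding graph_dist_def by auto
qed

lemma graph_dist_eq_2:
  assumes "pair_graph \<Gamma>" and "u \<noteq> v" "(u, v) \<notin> parcs \<Gamma>" "(u, w) \<in> parcs \<Gamma>" "(w, v) \<in> parcs \<Gamma>"
  shows "graph_dist \<Gamma> u v = 2"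
proof -
  interpret pair_graph \<Gamma> by fact
  have aw: "awalk u [(u, w), (w, v)] v"
    using assms by (auto simp: awalk_simps in_arcsD1 in_arcsD2)
  have "\<mu> (\<lambda>_. 1) u v = 2"
  proof (rule antisym)
    show "\<mu> (\<lambda>_. 1) u v \<le> 2"
      using min_cost_le_walk_cost[OF aw, of "\<lambda>_. 1"] by simp
    show "2 \<le> \<mu> (\<lambda>_. 1) u v"
      unfolding \<mu>_def
    proof (rule INF_greatest)
      fix p assume "p \<in> {p. awalk u p v}"
      then have p: "awalk u p v" by simp
      have len: "awalk_cost (\<lambda>_. 1) p = real (length p)"
        by (induction p) auto
      have "length p \<ge> 2"
      proof (rule ccontr)
        assume "\<not> length p \<ge> 2"
        then consider "p = []" | e where "p = [e]"
          by (cases p; cases "tl p") auto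
        then show False
          using p assms(2,3) by cases (auto simp: awalk_simps)
      qed
      then show "2 \<le> ereal (awalk_cost (\<lambda>_. 1) p)"
        unfolding len by (metis ereal_less_eq(3) numeral_eq_ereal of_nat_le_iff of_nat_numeral)
    qed
  qed
  then show ?thesis by (simp add: graph_dist_def)
qed

lemma L21_labeling_inj_on:
  assumes "pair_graph \<Gamma>" and "L21_labeling \<Gamma> f" and "d \<in> dominating_vertices \<Gamma>"
  shows "inj_on f (pverts \<Gamma>)"
proof (rule inj_onI, rule ccontr)
  interpret pair_graph \<Gamma> by fact
  fix u v assume uv: "u \<in> pverts \<Gamma>" "v \<in> pverts \<Gamma>" "f u = f v" "u \<noteq> v"
  have d: "(d, x) \<in> parcs \<Gamma>" "(x, d) \<in> parcs \<Gamma>" if "x \<in> pverts \<Gamma>" "x \<noteq> d" for x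
    using assms(3) that arcs_symmetric by (auto simp: dominating_vertices_def)
  have "(u, v) \<notin> parcs \<Gamma>"
    using assms(2) uv by (force simp: L21_labeling_def)
  moreover from this have "graph_dist \<Gamma> u v = 2"
    using graph_dist_eq_2[OF assms(1), of u v d] d uv by metis
  ultimately show False
    using assms(2) uv by (force simp: L21_labeling_def)
qed

lemma L21_labeling_span_ge:
  assumes "pair_graph \<Gamma>" and "L21_labeling \<Gamma> f"
    and "dominating_vertices \<Gamma> \<noteq> {}" and "dominating_vertices \<Gamma> \<noteq> pverts \<Gamma>"
  shows "labeling_span \<Gamma> f \<ge> int (card (pverts \<Gamma>) + card (dominating_vertices \<Gamma>)) - 1"
proof -
  interpret pair_graph \<Gamma> by fact
  let ?V = "pverts \<Gamma>" and ?D = "dominating_vertices \<Gamma>"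
  have fin: "finite ?V" by (rule pair_finite_verts)
  have DV: "?D \<subseteq> ?V" by (auto simp: dominating_vertices_def)
  have inj: "inj_on f ?V"
    using L21_labeling_inj_on[OF assms(1,2)] assms(3) by blast
  have far: "\<bar>f d - f x\<bar> \<ge> 2" if "d \<in> ?D" "x \<in> ?V" "x \<noteq> d" for d x
    using that assms(2) DV by (auto simp: dominating_vertices_def L21_labeling_def)
  obtain v where v: "v \<in> ?V" "v \<notin> ?D" using DV assms(4) by auto
  \<comment> \<open>The integer next to the label of \<open>d\<close> on the side of the label of \<open>v\<close>. It is never a
    label, and it stays between the minimum and the maximum.\<close>
  define g where "g d = (if f d < f v then f d + 1 else f d - 1)" for d
  have fv: "\<bar>f d - f v\<bar> \<ge> 2" if "d \<in> ?D" for d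
    using far[of d v] that v by auto
  have "inj_on g ?D"
  proof (rule inj_onI, rule ccontr)
    fix d e assume *: "d \<in> ?D" "e \<in> ?D" "g d = g e" "d \<noteq> e"
    then have "\<bar>f d - f e\<bar> \<ge> 2" using far[of d e] DV by auto
    then show False using * fv[of d] fv[of e] by (auto simp: g_def split: if_splits)
  qed
  then have cardg: "card (g ` ?D) = card ?D" by (rule card_image)
  have disj: "f ` ?V \<inter> g ` ?D = {}"
  proof (rule ccontr)
    assume "f ` ?V \<inter> g ` ?D \<noteq> {}"
    then obtain x d where "x \<in> ?V" "d \<in> ?D" "f x = g d" by auto
    then show False
      using far[of d x] by (cases "x = d") (auto simp: g_def split: if_splits)
  qed
  let ?m = "Min (f ` ?V)" and ?M = "Max (f ` ?V)"
  have bnd: "?m \<le> f x" "f x \<le> ?M" if "x \<in> ?V" for x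
    using that fin by auto
  have "f ` ?V \<union> g ` ?D \<subseteq> {?m..?M}"
  proof
    fix i assume "i \<in> f ` ?V \<union> g ` ?D"
    then consider x where "x \<in> ?V" "i = f x" | d where "d \<in> ?D" "i = g d" by auto
    then show "i \<in> {?m..?M}"
    proof cases
      case 1 then show ?thesis using bnd by auto
    next
      case 2
      then have "?m \<le> f d" "f d \<le> ?M" "?m \<le> f v" "f v \<le> ?M" using bnd DV v by blast+
      then show ?thesis using 2 fv[of d] by (auto simp: g_def)
    qed
  qed
  then have "card (f ` ?V \<union> g ` ?D) \<le> card {?m..?M}"
    by (intro card_mono) auto
  moreover have "card (f ` ?V \<union> g ` ?D) = card ?V + card ?D"
    using disj fin DV inj cardg by (subst card_Un_disjoint) (auto simp: card_image finite_subset)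
  moreover have "card ?V > 0" using v fin by (auto simp: card_gt_0_iff)
  ultimately show ?thesis
    by (simp add: labeling_span_def)
qed

text \<open>The \<open>m\<close> vertices of the path receive \<open>0, \<dots>, m - 1\<close>, the dominating vertices
  \<open>m + 1, m + 3, \<dots>\<close>.\<close>

lemma L21_labeling_of_path:
  assumes "pair_graph \<Gamma>" and "dominating_vertices \<Gamma> \<noteq> {}" and "xs \<noteq> []"
    and "distinct xs" "set xs = pverts \<Gamma> - dominating_vertices \<Gamma>"
    and "successively (\<lambda>u v. (u, v) \<notin> parcs \<Gamma>) xs"
  shows "\<exists>f. L21_labeling \<Gamma> f \<and>
    labeling_span \<Gamma> f = int (card (pverts \<Gamma>) + card (dominating_vertices \<Gamma>) - 1)"
proof -
  interpret pair_graph \<Gamma> by fact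
  let ?V = "pverts \<Gamma>" and ?D = "dominating_vertices \<Gamma>"
  have fin: "finite ?V" by (rule pair_finite_verts)
  have DV: "?D \<subseteq> ?V" by (auto simp: dominating_vertices_def)
  then have "finite ?D" using fin finite_subset by blast
  then obtain ds where ds: "distinct ds" "set ds = ?D" using finite_distinct_list by blast
  define m t where "m = length xs" and "t = length ds"
  have m: "m + t = card ?V" "t = card ?D" "m \<ge> 1" "t \<ge> 1"
  proof -
    show t: "t = card ?D" using ds by (metis distinct_card t_def)
    have "m = card (?V - ?D)" using assms(4,5) by (metis distinct_card m_def)
    then show "m + t = card ?V"
      using t DV fin by (simp add: card_Diff_subset finite_subset card_mono)
    show "m \<ge> 1" using assms(3) by (simp add: m_def Suc_leI)
    show "t \<ge> 1" using t \<open>finite ?D\<close> assms(2) by (simp add: Suc_leI card_gt_0_iff)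
  qed
  define f where "f x = (if x \<in> ?D then int (m + 1 + 2 * (THE i. i < t \<and> ds ! i = x))
    else int (THE i. i < m \<and> xs ! i = x))" for x
  have fd: "f (ds ! i) = int (m + 1 + 2 * i)" if "i < t" for i
  proof -
    have "(THE j. j < t \<and> ds ! j = ds ! i) = i"
      using that ds(1) by (intro the_equality) (auto simp: t_def nth_eq_iff_index_eq)
    then show ?thesis using that ds by (simp add: f_def t_def flip: ds(2))
  qed
  have fx: "f (xs ! i) = int i" if "i < m" for i
  proof -
    have "(THE j. j < m \<and> xs ! j = xs ! i) = i"
      using that assms(4) by (intro the_equality) (auto simp: m_def nth_eq_iff_index_eq)
    moreover have "xs ! i \<notin> ?D" using assms(5) that nth_mem[of i xs] by (auto simp: m_def)
    ultimately show ?thesis by (simp add: f_def)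
  qed
  have vert: "(\<exists>i<m. x = xs ! i) \<or> (\<exists>i<t. x = ds ! i)" if "x \<in> ?V" for x
    using that ds(2) assms(5) by (metis DiffI in_set_conv_nth m_def t_def)
  have memV: "xs ! i \<in> ?V" if "i < m" for i using that assms(5) nth_mem[of i xs] by (auto simp: m_def)
  have memD: "ds ! i \<in> ?V" if "i < t" for i using that ds DV nth_mem[of i ds] by (auto simp: t_def)
  have step: "(xs ! i, xs ! Suc i) \<notin> parcs \<Gamma>" "(xs ! Suc i, xs ! i) \<notin> parcs \<Gamma>" if "Suc i < m" for i
    using that assms(6) arcs_symmetric by (auto simp: successively_conv_nth m_def)
  have two: "\<bar>f u - f v\<bar> \<ge> 2" if uv: "u \<in> ?V" "v \<in> ?V" "(u, v) \<in> parcs \<Gamma>" for u v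
  proof -
    have ne: "u \<noteq> v" using pair_no_loops[OF uv(3)] by simp
    show ?thesis using vert[OF uv(1)]
    proof (elim disjE exE conjE)
      fix i assume i: "i < m" "u = xs ! i"
      show ?thesis using vert[OF uv(2)]
      proof (elim disjE exE conjE)
        fix j assume j: "j < m" "v = xs ! j"
        have "i \<noteq> j" "j \<noteq> Suc i" "i \<noteq> Suc j"
          using step i j uv ne by auto
        then show ?thesis using i j fx by auto
      next
        fix j assume "j < t" "v = ds ! j"
        then show ?thesis using i fx fd by auto
      qed
    next
      fix i assume i: "i < t" "u = ds ! i"
      show ?thesis using vert[OF uv(2)]
      proof (elim disjE exE conjE)
        fix j assume j: "j < t" "v = ds ! j"
        then show ?thesis using i fd ne by (cases i j rule: linorder_cases) auto
      next
        fix j assume "j < m" "v = xs ! j"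
        then show ?thesis using i fx fd by auto
      qed
    qed
  qed
  have inj: "\<bar>f u - f v\<bar> \<ge> 1" if uv: "u \<in> ?V" "v \<in> ?V" "u \<noteq> v" for u v
  proof -
    have "f u \<noteq> f v"
    proof (rule notI)
      assume "f u = f v"
      with vert[OF uv(1)] vert[OF uv(2)] uv(3) show False
        by (elim disjE exE conjE) (simp_all add: fx fd)
    qed
    then show ?thesis by linarith
  qed
  have "L21_labeling \<Gamma> f"
    unfolding L21_labeling_def using two inj graph_dist_self_neq_2[OF assms(1)] by blast
  moreover have "labeling_span \<Gamma> f = int (m + 2 * t - 1)"
  proof -
    have "Min (f ` ?V) = 0"
    proof (rule Min_eqI)
      show "0 \<in> f ` ?V" using fx[of 0] memV[of 0] m(3) by (metis image_eqI int_ops(1) less_eq_Suc_le One_nat_def)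
      show "0 \<le> y" if "y \<in> f ` ?V" for y using that by (auto simp: f_def)
    qed (use fin in auto)
    moreover have "Max (f ` ?V) = int (m + 2 * t - 1)"
    proof (rule Max_eqI)
      have "f (ds ! (t - 1)) = int (m + 2 * t - 1)" using fd[of "t - 1"] m(4) by auto
      then show "int (m + 2 * t - 1) \<in> f ` ?V" using memD[of "t - 1"] m(4) by (metis diff_less image_eqI less_one less_le_trans)
      show "y \<le> int (m + 2 * t - 1)" if y: "y \<in> f ` ?V" for y
      proof -
        obtain x where "x \<in> ?V" "y = f x" using y by auto
        with vert[of x] show ?thesis using fx fd m(3,4) by auto
      qed
    qed (use fin in auto)
    ultimately show ?thesis by (simp add: labeling_span_def)
  qed
  ultimately show ?thesis using m(1,2) by (intro exI[of _ f]) auto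
qed

lemma lambda_number_eq_of_path:
  assumes "pair_graph \<Gamma>" and "dominating_vertices \<Gamma> \<noteq> {}" and "xs \<noteq> []"
    and "distinct xs" "set xs = pverts \<Gamma> - dominating_vertices \<Gamma>"
    and "successively (\<lambda>u v. (u, v) \<notin> parcs \<Gamma>) xs"
  shows "lambda_number \<Gamma> = card (pverts \<Gamma>) + card (dominating_vertices \<Gamma>) - 1"
  unfolding lambda_number_def
proof (rule Least_equality)
  show "\<exists>f. L21_labeling \<Gamma> f \<and>
    labeling_span \<Gamma> f = int (card (pverts \<Gamma>) + card (dominating_vertices \<Gamma>) - 1)"
    by (rule L21_labeling_of_path[OF assms])
  have "dominating_vertices \<Gamma> \<noteq> pverts \<Gamma>"
    using assms(3,5) by (metis Diff_cancel set_empty)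
  then show "card (pverts \<Gamma>) + card (dominating_vertices \<Gamma>) - 1 \<le> k"
    if "\<exists>f. L21_labeling \<Gamma> f \<and> labeling_span \<Gamma> f = int k" for k
    using that L21_labeling_span_ge[OF assms(1) _ assms(2)] by force
qed

section \<open>Finite nilpotent groups\<close>

lemma (in group) generate_singleton_iff:
  assumes "finite (carrier G)" "y \<in> carrier G"
  shows "z \<in> generate G {y} \<longleftrightarrow> (\<exists>k::nat. z = y [^] k)"
  using generate_pow_on_finite_carrier[OF assms] by auto

lemma (in group) inv_mult_cancel:
  assumes "x \<in> carrier G" "y \<in> carrier G"
  shows "inv x \<otimes> (x \<otimes> y) = y" and "x \<otimes> (inv x \<otimes> y) = y"
  using assms by (simp_all flip: m_assoc)

lemma (in group) pow_eq_of_cong: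
  assumes "x \<in> carrier G" and "[a = b] (mod ord x)"
  shows "x [^] a = x [^] (b::nat)"
proof -
  have "int (ord x) dvd int b - int a"
    using assms(2) by (metis cong_iff_dvd_diff cong_int_iff cong_sym)
  then show ?thesis using int_pow_eq[OF assms(1)] by (metis int_pow_int)
qed

lemma (in group) pow_mult_commutator:
  assumes "x \<in> carrier G" "y \<in> carrier G" "z \<in> carrier G"
    and "z \<otimes> x = x \<otimes> z" and "x \<otimes> y = z \<otimes> y \<otimes> x"
  shows "x [^] (n::nat) \<otimes> y = z [^] n \<otimes> y \<otimes> x [^] n"
proof (induction n)
  case 0
  then show ?case using assms by simp
next
  case (Suc n)
  have "x [^] Suc n \<otimes> y = x [^] n \<otimes> (x \<otimes> y)"
    using assms by (simp add: m_assoc)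
  also have "\<dots> = x [^] n \<otimes> z \<otimes> (y \<otimes> x)"
    using assms by (simp add: m_assoc)
  also have "x [^] n \<otimes> z = z \<otimes> x [^] n"
    using group_commutes_pow[OF assms(4)[symmetric]] assms by simp
  also have "z \<otimes> x [^] n \<otimes> (y \<otimes> x) = z \<otimes> (x [^] n \<otimes> y) \<otimes> x"
    using assms by (simp add: m_assoc)
  also have "\<dots> = z \<otimes> z [^] n \<otimes> y \<otimes> (x [^] n \<otimes> x)"
    unfolding Suc using assms by (simp add: m_assoc)
  finally show ?case
    using assms nat_pow_Suc2 by auto
qed

lemma (in group) conjugate_mult:
  assumes "a \<in> carrier G" "x \<in> carrier G" "y \<in> carrier G"
  shows "a \<otimes> x \<otimes> inv a \<otimes> (a \<otimes> y \<otimes> inv a) = a \<otimes> (x \<otimes> y) \<otimes> inv a"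
  using assms by (metis inv_closed inv_solve_right m_assoc m_closed)

lemma (in group) lower_central_normal: "lower_central G i \<lhd> G"
proof (induction i)
  case 0
  then show ?case using normal_self by simp
next
  case (Suc i)
  interpret N: normal "lower_central G i" G by fact
  let ?S = "{h \<otimes> g \<otimes> inv h \<otimes> inv g | h g. h \<in> lower_central G i \<and> g \<in> carrier G}"
  have "generate G ?S \<lhd> G"
  proof (rule normal_generateI)
    show "?S \<subseteq> carrier G" using N.subset by auto
    fix c a assume "c \<in> ?S" and a: "a \<in> carrier G"
    then obtain h g where hg: "c = h \<otimes> g \<otimes> inv h \<otimes> inv g" "h \<in> lower_central G i" "g \<in> carrier G"
      by auto
    have hc: "h \<in> carrier G" using hg N.subset by auto
    let ?h = "a \<otimes> h \<otimes> inv a" and ?g = "a \<otimes> g \<otimes> inv a"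
    have "a \<otimes> c \<otimes> inv a = ?h \<otimes> ?g \<otimes> inv ?h \<otimes> inv ?g"
    proof -
      have inv: "inv (a \<otimes> x \<otimes> inv a) = a \<otimes> inv x \<otimes> inv a" if "x \<in> carrier G" for x
        using a that by (simp add: inv_mult_group m_assoc)
      show ?thesis
        using a hg(3) hc by (simp add: hg(1) inv conjugate_mult)
    qed
    moreover have "?h \<in> lower_central G i" using N.inv_op_closed2 a hg by blast
    ultimately show "a \<otimes> c \<otimes> inv a \<in> ?S" using a hg by blast
  qed
  then show ?case by simp
qed

lemma (in group) commutator_in_lower_central:
  assumes "h \<in> lower_central G i" "g \<in> carrier G"
  shows "h \<otimes> g \<otimes> inv h \<otimes> inv g \<in> lower_central G (Suc i)"
  using assms by (auto intro: generate.incl)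

lemma (in group) central_commutator_eq_one:
  assumes x: "x \<in> carrier G" and y: "y \<in> carrier G" and z: "z \<in> carrier G"
    and zx: "z \<otimes> x = x \<otimes> z" and zy: "z \<otimes> y = y \<otimes> z" and xy: "x \<otimes> y = z \<otimes> y \<otimes> x"
    and m: "x [^] (m::nat) = \<one>" and n: "y [^] (n::nat) = \<one>" and cop: "coprime m n"
  shows "z = \<one>"
proof -
  have "y = z [^] m \<otimes> y"
    using pow_mult_commutator[OF x y z zx xy, of m] m x y z by simp
  then have "z [^] m = \<one>" using y z by simp
  moreover have "z [^] n = \<one>"
  proof -
    have iz: "inv z \<otimes> y = y \<otimes> inv z"
      using zy y z by (metis inv_closed inv_solve_left inv_solve_right m_assoc m_closed)
    have "y \<otimes> x = inv z \<otimes> (x \<otimes> y)"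
      using x y z by (simp add: xy m_assoc[symmetric])
    then have "y \<otimes> x = inv z \<otimes> x \<otimes> y"
      using x y z by (simp add: m_assoc)
    from pow_mult_commutator[OF y x _ iz this, of n] have "x = inv z [^] n \<otimes> x"
      using n x y z by simp
    then have "inv z [^] n = \<one>" using x z by simp
    then show ?thesis using z by (simp add: nat_pow_inv)
  qed
  ultimately have "ord z dvd m" "ord z dvd n" using z by (simp_all add: pow_eq_id)
  then have "ord z = 1" using cop by (metis coprime_common_divisor_nat)
  then show ?thesis using z ord_eq_1 by blast
qed

text \<open>By induction along the lower central series the commutator of the two elements lies in
  every term: modulo the next term it is central, hence trivial as the orders are coprime.\<close>

lemma (in group) nilpotent_coprime_commute:
  assumes "nilpotent_group G" and x: "x \<in> carrier G" and y: "y \<in> carrier G"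
    and cop: "coprime (ord x) (ord y)"
  shows "x \<otimes> y = y \<otimes> x"
proof -
  define z where "z = x \<otimes> y \<otimes> inv x \<otimes> inv y"
  have z: "z \<in> carrier G" using x y by (simp add: z_def)
  have zyx: "x \<otimes> y = z \<otimes> y \<otimes> x" using x y by (simp add: z_def m_assoc)
  have "z \<in> lower_central G i" for i
  proof (induction i)
    case 0
    then show ?case using z by simp
  next
    case (Suc i)
    define N where "N = lower_central G (Suc i)"
    interpret N: normal N G unfolding N_def by (rule lower_central_normal)
    interpret Q: group "G Mod N" by (rule N.factorgroup_is_group)
    interpret h: group_hom G "G Mod N" "\<lambda>a. N #> a"
      by unfold_locales (rule N.r_coset_hom_Mod)
    have central: "(N #> z) \<otimes>\<^bsub>G Mod N\<^esub> (N #> g) = (N #> g) \<otimes>\<^bsub>G Mod N\<^esub> (N #> z)"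
      if g: "g \<in> carrier G" for g
    proof -
      let ?c = "z \<otimes> g \<otimes> inv z \<otimes> inv g"
      have c: "?c \<in> N" unfolding N_def by (rule commutator_in_lower_central[OF Suc g])
      have cc: "?c \<in> carrier G" "g \<otimes> z \<in> carrier G" using z g by auto
      have "z \<otimes> g = ?c \<otimes> (g \<otimes> z)" using z g by (simp add: m_assoc inv_mult_cancel)
      then have "N #> (z \<otimes> g) = (N #> ?c) \<otimes>\<^bsub>G Mod N\<^esub> (N #> (g \<otimes> z))"
        using h.hom_mult[OF cc] by metis
      also have "N #> ?c = \<one>\<^bsub>G Mod N\<^esub>"
        using coset_join2[OF cc(1) N.subgroup_axioms c] by simp
      also have "\<one>\<^bsub>G Mod N\<^esub> \<otimes>\<^bsub>G Mod N\<^esub> (N #> (g \<otimes> z)) = N #> (g \<otimes> z)"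
        by (rule Q.l_one[OF h.hom_closed[OF cc(2)]])
      finally show ?thesis using h.hom_mult[OF z g] h.hom_mult[OF g z] by metis
    qed
    have xy: "(N #> x) \<otimes>\<^bsub>G Mod N\<^esub> (N #> y)
        = (N #> z) \<otimes>\<^bsub>G Mod N\<^esub> (N #> y) \<otimes>\<^bsub>G Mod N\<^esub> (N #> x)"
      using h.hom_mult[OF x y] h.hom_mult[OF z y] h.hom_mult[OF m_closed[OF z y] x] zyx by metis
    have pow: "(N #> a) [^]\<^bsub>G Mod N\<^esub> ord a = \<one>\<^bsub>G Mod N\<^esub>" if "a \<in> carrier G" for a
      using h.hom_nat_pow[OF that, of "ord a"] h.hom_one that by (metis pow_ord_eq_1)
    have "N #> z = \<one>\<^bsub>G Mod N\<^esub>"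
      by (rule Q.central_commutator_eq_one[OF h.hom_closed[OF x] h.hom_closed[OF y]
            h.hom_closed[OF z] central[OF x] central[OF y] xy pow[OF x] pow[OF y] cop])
    then have "N #> z = N" by simp
    then show ?case using coset_join1[OF _ z N.subgroup_axioms] by (simp add: N_def)
  qed
  then have "z = \<one>" using assms(1) by (auto simp: nilpotent_group_def)
  then show ?thesis using zyx x y by simp
qed

text \<open>Normalizers grow, also within a subgroup \<open>P\<close>: take \<open>h\<close> in the last term of the lower central
  series whose intersection with \<open>P\<close> is not contained in \<open>H\<close>.\<close>

lemma (in group) nilpotent_normalizer_grows:
  assumes "nilpotent_group G" and P: "subgroup P G" and H: "subgroup H G" and "H \<subset> P"
  shows "\<exists>h \<in> P - H. \<forall>g \<in> H. h \<otimes> g \<otimes> inv h \<in> H"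
proof -
  interpret P: subgroup P G by fact
  interpret H: subgroup H G by fact
  obtain c where c: "lower_central G c = {\<one>}" using assms(1) by (auto simp: nilpotent_group_def)
  let ?Q = "\<lambda>i. lower_central G i \<inter> P \<subseteq> H"
  have "?Q c" using c H.one_closed by auto
  moreover have "\<not> ?Q 0" using assms(4) P.subset by auto
  ultimately obtain i where i: "\<not> ?Q i" "?Q (Suc i)"
    using nat_induct[of "\<lambda>i. \<not> ?Q i" c] by blast
  then obtain h where h: "h \<in> lower_central G i" "h \<in> P" "h \<notin> H" by auto
  have "h \<otimes> g \<otimes> inv h \<in> H" if g: "g \<in> H" for g
  proof -
    have gP: "g \<in> P" using g assms(4) by auto
    let ?c = "h \<otimes> g \<otimes> inv h \<otimes> inv g"
    have "?c \<in> lower_central G (Suc i)"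
      using commutator_in_lower_central[OF h(1)] g H.subset by auto
    moreover have "?c \<in> P" using h(2) gP by auto
    ultimately have "?c \<in> H" using i(2) by auto
    then have "?c \<otimes> g \<in> H" using g by auto
    moreover have "?c \<otimes> g = h \<otimes> g \<otimes> inv h"
      using P.mem_carrier[OF h(2)] P.mem_carrier[OF gP] by (simp add: m_assoc)
    ultimately show ?thesis by simp
  qed
  then show ?thesis using h by auto
qed

lemma (in group) card_subgroup_dvd_card_subgroup:
  assumes "subgroup H G" "subgroup K G" "H \<subseteq> K"
  shows "card H dvd card K"
proof -
  have "card (rcosets\<^bsub>G\<lparr>carrier := K\<rparr>\<^esub> H) * card H = order (G\<lparr>carrier := K\<rparr>)"
    by (rule group.lagrange[OF subgroup_imp_group[OF assms(2)] subgroup_incl[OF assms]])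
  also have "\<dots> = card K" by (simp add: order_def)
  finally show ?thesis by (metis dvd_triv_right)
qed

lemma (in group) mem_normal_if_coprime_index:
  assumes N: "N \<lhd> G" and x: "x \<in> carrier G" and cop: "coprime (ord x) (order (G Mod N))"
  shows "x \<in> N"
proof -
  interpret N: normal N G by (rule N)
  interpret Q: group "G Mod N" by (rule N.factorgroup_is_group)
  interpret h: group_hom G "G Mod N" "\<lambda>a. N #> a"
    by unfold_locales (rule N.r_coset_hom_Mod)
  have Nx: "N #> x \<in> carrier (G Mod N)" by (rule h.hom_closed[OF x])
  have "(N #> x) [^]\<^bsub>G Mod N\<^esub> ord x = \<one>\<^bsub>G Mod N\<^esub>"
    using h.hom_nat_pow[OF x, of "ord x"] h.hom_one x by (metis pow_ord_eq_1)
  then have dx: "Q.ord (N #> x) dvd ord x" by (rule iffD1[OF Q.pow_eq_id[OF Nx]])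
  have "Q.ord (N #> x) dvd order (G Mod N)" by (rule Q.ord_dvd_group_order[OF Nx])
  with dx have "is_unit (Q.ord (N #> x))" by (rule coprime_common_divisor[OF cop])
  then have "Q.ord (N #> x) = 1" by simp
  then have "N #> x = N" using Q.ord_eq_1[OF Nx] by simp
  then show ?thesis using coset_join1[OF _ x N.subgroup_axioms] by simp
qed

text \<open>The normalizer of \<open>P\<close> contains a Sylow subgroup for every prime, because elements of coprime
  orders commute. Hence \<open>P\<close> is normal, and it contains all \<open>p\<close>-elements as its index is prime
  to \<open>p\<close>.\<close>

lemma (in group) nilpotent_sylow_contains_primary:
  assumes fin: "finite (carrier G)" and nil: "nilpotent_group G" and p: "Factorial_Ring.prime p"
  shows "\<exists>P. sylow_subgroup G p P \<and> (\<forall>x \<in> carrier G. \<forall>k. ord x = p ^ k \<longrightarrow> x \<in> P)"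
proof -
  have og: "order G > 0" using fin by (simp add: order_gt_0_iff_finite)
  have ex: "\<exists>Q. sylow_subgroup G q Q" if q: "Factorial_Ring.prime q" for q
  proof -
    have "order G = q ^ multiplicity q (order G) * (order G div q ^ multiplicity q (order G))"
      by (simp add: multiplicity_dvd)
    from sylow_thm[OF q is_group this fin] show ?thesis by (auto simp: sylow_subgroup_def)
  qed
  obtain P where P: "sylow_subgroup G p P" using ex[OF p] by auto
  interpret P: subgroup P G using P by (simp add: sylow_subgroup_def)
  have ordS: "\<exists>k. ord x = q ^ k" if "sylow_subgroup G q Q" "x \<in> Q" "Factorial_Ring.prime q" for q Q x
  proof -
    have Q: "subgroup Q G" "card Q = q ^ multiplicity q (order G)" using that by (auto simp: sylow_subgroup_def)
    have x: "x \<in> carrier G" using that(2) subgroup.subset[OF Q(1)] by blast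
    have "generate G {x} \<subseteq> Q" using generate_subgroup_incl[OF _ Q(1), of "{x}"] that by auto
    then have "card (generate G {x}) dvd card Q"
      using x by (intro card_subgroup_dvd_card_subgroup[OF generate_is_subgroup Q(1)]) auto
    then have "ord x dvd q ^ multiplicity q (order G)" using generate_pow_card[OF x] Q(2) by simp
    then show ?thesis using divides_primepow_nat[OF that(3)] by blast
  qed
  \<comment> \<open>The normalizer of \<open>P\<close>.\<close>
  define N where "N = {g \<in> carrier G. \<forall>u \<in> P. g \<otimes> u \<otimes> inv g \<in> P}"
  have finP: "finite P" using P.subset fin finite_subset by blast
  have N: "subgroup N G"
  proof (rule subgroupI)
    show "N \<subseteq> carrier G" by (auto simp: N_def)
    show "N \<noteq> {}" unfolding N_def using P.subset by (auto intro!: exI[of _ \<one>])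
    fix a assume a: "a \<in> N"
    have ac: "a \<in> carrier G" using a by (simp add: N_def)
    have "inj_on (\<lambda>u. a \<otimes> u \<otimes> inv a) P"
    proof (rule inj_onI)
      fix u v assume uv: "u \<in> P" "v \<in> P" "a \<otimes> u \<otimes> inv a = a \<otimes> v \<otimes> inv a"
      note car = P.mem_carrier[OF uv(1)] P.mem_carrier[OF uv(2)]
      have "a \<otimes> u = a \<otimes> v"
        using right_cancel[of "inv a" "a \<otimes> u" "a \<otimes> v"] uv(3) ac car by simp
      then show "u = v" using ac car by (metis Units_eq Units_l_cancel)
    qed
    then have surj: "(\<lambda>u. a \<otimes> u \<otimes> inv a) ` P = P"
      using a finP by (intro endo_inj_surj) (auto simp: N_def)
    have "inv a \<otimes> u \<otimes> a \<in> P" if "u \<in> P" for u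
    proof -
      obtain v where v: "v \<in> P" "u = a \<otimes> v \<otimes> inv a" using surj \<open>u \<in> P\<close> by auto
      then have "inv a \<otimes> u \<otimes> a = v" using ac P.mem_carrier[OF v(1)] by (simp add: m_assoc inv_mult_cancel)
      then show ?thesis using v by simp
    qed
    then show "inv a \<in> N" using ac by (simp add: N_def)
    fix b assume b: "b \<in> N"
    have bc: "b \<in> carrier G" using b by (simp add: N_def)
    have "a \<otimes> b \<otimes> u \<otimes> inv (a \<otimes> b) = a \<otimes> (b \<otimes> u \<otimes> inv b) \<otimes> inv a" if "u \<in> P" for u
      using ac bc P.mem_carrier[OF that] by (simp add: inv_mult_group m_assoc)
    then show "a \<otimes> b \<in> N" using a b ac bc by (simp add: N_def)
  qed
  have sub: "Q \<subseteq> N" if q: "Factorial_Ring.prime q" and Q: "sylow_subgroup G q Q" "q = p \<longrightarrow> Q = P" for q Q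
  proof
    interpret Q: subgroup Q G using Q by (simp add: sylow_subgroup_def)
    fix g assume g: "g \<in> Q"
    show "g \<in> N"
    proof (cases "q = p")
      case True
      then show ?thesis using g Q by (auto simp: N_def)
    next
      case False
      have "g \<otimes> u \<otimes> inv g = u" if u: "u \<in> P" for u
      proof -
        obtain i j where "ord g = q ^ i" "ord u = p ^ j" using ordS[OF Q(1) g q] ordS[OF P u p] by auto
        then have "coprime (ord g) (ord u)" using False p q by (simp add: primes_coprime)
        then have "g \<otimes> u = u \<otimes> g" by (rule nilpotent_coprime_commute[OF nil Q.mem_carrier[OF g] P.mem_carrier[OF u]])
        then show ?thesis using g u by (simp add: m_assoc)
      qed
      then show ?thesis using g by (auto simp: N_def)
    qed
  qed
  have finN: "finite N" using fin subgroup.subset[OF N] finite_subset by blast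
  have cN: "card N > 0" using finN subgroup.one_closed[OF N] by (auto simp: card_gt_0_iff)
  have "order G dvd card N"
  proof (rule multiplicity_le_imp_dvd)
    show "order G \<noteq> 0" using og by simp
    fix q :: nat assume q: "Factorial_Ring.prime q"
    obtain Q where Q: "sylow_subgroup G q Q" "q = p \<longrightarrow> Q = P"
      using ex[OF q] P by (cases "q = p") auto
    have Qs: "subgroup Q G" "card Q = q ^ multiplicity q (order G)" using Q by (auto simp: sylow_subgroup_def)
    have "card Q dvd card N" by (rule card_subgroup_dvd_card_subgroup[OF Qs(1) N sub[OF q Q]])
    then show "multiplicity q (order G) \<le> multiplicity q (card N)"
      using Qs(2) cN q by (intro multiplicity_geI) auto
  qed
  then have "card N \<ge> card (carrier G)" using cN by (simp add: dvd_imp_le order_def)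
  then have NG: "N = carrier G" using fin subgroup.subset[OF N] by (simp add: card_seteq)
  have PG: "P \<lhd> G" using NG by (intro normal_invI) (auto simp: N_def P.subgroup_axioms)
  have "order (G Mod P) * card P = order G"
    using lagrange[OF P.subgroup_axioms] by (simp add: order_def FactGroup_def)
  moreover have "card P \<noteq> 0" using finP P.one_closed by (metis card_0_eq empty_iff)
  ultimately have "order (G Mod P) = order G div card P"
    by (metis nonzero_mult_div_cancel_right)
  moreover have "card P = p ^ multiplicity p (order G)"
    using P by (auto simp only: sylow_subgroup_def)
  ultimately have "order (G Mod P) = order G div p ^ multiplicity p (order G)"
    by (simp only:)
  moreover have "\<not> p dvd order G div p ^ multiplicity p (order G)"
    using og p by (intro multiplicity_decompose) auto
  ultimately have cop: "\<not> p dvd order (G Mod P)"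
    by (simp only:) simp
  have "x \<in> P" if x: "x \<in> carrier G" "ord x = p ^ k" for x k
    using cop p x by (intro mem_normal_if_coprime_index[OF PG]) (simp_all add: prime_imp_coprime)
  then show ?thesis using P by blast
qed

section \<open>Cyclic subgroups of non-cyclic \<open>p\<close>-groups, \<open>p\<close> odd\<close>

text \<open>With \<open>r = 1 + p * t\<close> the sum is congruent to \<open>p + p * t * p * (p - 1) / 2\<close>, and hence to \<open>p\<close>,
  modulo the square of \<open>p\<close>. The last step needs \<open>p\<close> odd.\<close>

lemma geometric_sum_mod_prime_square:
  fixes r p :: nat
  assumes p: "Factorial_Ring.prime p" "odd p" and r: "[r = 1] (mod p)"
  shows "\<exists>u. (\<Sum>i<p. r ^ i) = p * u \<and> coprime u p"
proof -
  have p0: "p > 0" using p(1) by (rule prime_gt_0_nat)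
  obtain t where t: "int r = 1 + int p * t"
    using r by (metis cong_iff_lin cong_int_iff cong_sym of_nat_1)
  have pw: "[int r ^ i = 1 + int i * int p * t] (mod (int p)\<^sup>2)" for i
  proof (induction i)
    case (Suc i)
    have "[int r * int r ^ i = (1 + int p * t) * (1 + int i * int p * t)] (mod (int p)\<^sup>2)"
      using Suc unfolding t by (intro cong_mult cong_refl)
    also have "(1 + int p * t) * (1 + int i * int p * t)
        = (1 + int (Suc i) * int p * t) + (int p)\<^sup>2 * (int i * t\<^sup>2)"
      by (simp add: algebra_simps power2_eq_square)
    also have "[\<dots> = 1 + int (Suc i) * int p * t] (mod (int p)\<^sup>2)"
      by (simp add: cong_def)
    finally show ?case by simp
  qed simp
  obtain k where k: "p = 2 * k + 1" using p(2) by (auto elim: oddE)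
  have gauss: "(\<Sum>i<p. int i) = int p * int k"
  proof -
    have "2 * (\<Sum>i<n. int i) = int n * (int n - 1)" for n
      by (induction n) (auto simp: algebra_simps)
    from this[of p] show ?thesis by (simp add: k algebra_simps)
  qed
  have "[(\<Sum>i<p. int r ^ i) = (\<Sum>i<p. 1 + int i * int p * t)] (mod (int p)\<^sup>2)"
    by (intro cong_sum pw)
  also have "(\<Sum>i<p. 1 + int i * int p * t) = int p + (\<Sum>i<p. int i) * (int p * t)"
    by (simp add: sum.distrib sum_distrib_right mult.assoc)
  also have "\<dots> = int p + (int p)\<^sup>2 * (int k * t)"
    unfolding gauss by (simp add: power2_eq_square)
  also have "[\<dots> = int p] (mod (int p)\<^sup>2)"
    by (simp add: cong_def)
  finally have "[int (\<Sum>i<p. r ^ i) = int p] (mod (int p)\<^sup>2)" by simp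
  then obtain c where c: "int (\<Sum>i<p. r ^ i) = int p + (int p)\<^sup>2 * c"
    by (metis cong_iff_lin cong_sym)
  then have c': "int (\<Sum>i<p. r ^ i) = int p * (1 + int p * c)"
    by (simp add: algebra_simps power2_eq_square)
  then have "int p dvd int (\<Sum>i<p. r ^ i)" by simp
  then have "p dvd (\<Sum>i<p. r ^ i)" by (simp only: int_dvd_int_iff)
  then obtain u where u: "(\<Sum>i<p. r ^ i) = p * u" by auto
  then have "int p * int u = int p * (1 + int p * c)" using c' by (metis of_nat_mult)
  then have "int u = 1 + int p * c" using p0 by simp
  then have "coprime (int u) (int p)"
    by (metis coprime_1_left coprime_iff_gcd_eq_1 gcd.commute gcd_add_mult mult.commute add.commute)
  then have "coprime u p" by simp
  then show ?thesis using u by blast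
qed

lemma (in group) pow_conjugating:
  assumes h: "h \<in> carrier G" and y: "y \<in> carrier G" and r: "h \<otimes> y = y [^] (r::nat) \<otimes> h"
  shows "h [^] (n::nat) \<otimes> y [^] (a::nat) = y [^] (r ^ n * a) \<otimes> h [^] n"
proof -
  have one: "h \<otimes> y [^] (a::nat) = y [^] (r * a) \<otimes> h" for a
  proof (induction a)
    case 0
    then show ?case using h by simp
  next
    case (Suc a)
    have "h \<otimes> y [^] Suc a = h \<otimes> y [^] a \<otimes> y" using h y by (simp add: m_assoc)
    also have "\<dots> = y [^] (r * a) \<otimes> (h \<otimes> y)" unfolding Suc using h y by (simp add: m_assoc)
    also have "\<dots> = y [^] (r * a) \<otimes> y [^] r \<otimes> h" unfolding r using h y by (simp add: m_assoc)
    also have "\<dots> = y [^] (r * Suc a) \<otimes> h" using y by (simp add: nat_pow_mult add.commute)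
    finally show ?case .
  qed
  show ?thesis
  proof (induction n arbitrary: a)
    case 0
    then show ?case using h y by simp
  next
    case (Suc n)
    have "h [^] Suc n \<otimes> y [^] a = h [^] n \<otimes> (h \<otimes> y [^] a)" using h y by (simp add: m_assoc)
    also have "\<dots> = h [^] n \<otimes> y [^] (r * a) \<otimes> h" unfolding one using h y by (simp add: m_assoc)
    also have "\<dots> = y [^] (r ^ n * (r * a)) \<otimes> (h [^] n \<otimes> h)" unfolding Suc using h y by (simp add: m_assoc)
    finally show ?case by (simp add: mult_ac)
  qed
qed

lemma (in group) pow_mult_conjugating:
  assumes h: "h \<in> carrier G" and y: "y \<in> carrier G" and r: "h \<otimes> y = y [^] (r::nat) \<otimes> h"
  shows "(y [^] (j::nat) \<otimes> h) [^] (n::nat) = y [^] (j * (\<Sum>i<n. r ^ i)) \<otimes> h [^] n"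
proof (induction n)
  case 0
  then show ?case by simp
next
  case (Suc n)
  have "(y [^] j \<otimes> h) [^] Suc n = y [^] (j * (\<Sum>i<n. r ^ i)) \<otimes> h [^] n \<otimes> (y [^] j \<otimes> h)"
    using Suc by simp
  also have "\<dots> = y [^] (j * (\<Sum>i<n. r ^ i)) \<otimes> (h [^] n \<otimes> y [^] j) \<otimes> h"
    using h y by (simp add: m_assoc)
  also have "\<dots> = y [^] (j * (\<Sum>i<n. r ^ i)) \<otimes> y [^] (r ^ n * j) \<otimes> (h [^] n \<otimes> h)"
    unfolding pow_conjugating[OF assms] using h y by (simp add: m_assoc)
  also have "\<dots> = y [^] (j * (\<Sum>i<Suc n. r ^ i)) \<otimes> h [^] Suc n"
    using y by (simp add: nat_pow_mult algebra_simps)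
  finally show ?case .
qed

lemma (in group) cyclic_group_generate_singleton:
  assumes "y \<in> carrier G"
  shows "cyclic_group (G\<lparr>carrier := generate G {y}\<rparr>)"
proof -
  have sub: "subgroup (generate G {y}) G" using assms by (intro generate_is_subgroup) auto
  interpret S: group "G\<lparr>carrier := generate G {y}\<rparr>" by (rule subgroup_imp_group[OF sub])
  have y: "y \<in> generate G {y}" by (simp add: generate.incl)
  have "generate G {y} = range (\<lambda>n::int. y [^]\<^bsub>G\<lparr>carrier := generate G {y}\<rparr>\<^esub> n)"
    using generate_pow[OF assms] int_pow_consistent[OF sub y] by (simp add: full_SetCompr_eq)
  then show ?thesis using y S.cyclic_group by auto
qed

lemma (in group) odd_noncyclic_second_primary:
  assumes fin: "finite (carrier G)" and nil: "nilpotent_group G"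
    and p: "Factorial_Ring.prime p" "odd p"
    and noncyc: "\<And>P. sylow_subgroup G p P \<Longrightarrow> \<not> cyclic_group (G\<lparr>carrier := P\<rparr>)"
    and x: "x \<in> carrier G" "ord x = p ^ k" "k \<ge> 1"
  shows "\<exists>w \<in> carrier G. ord w = p ^ k \<and> w \<notin> generate G {x}"
proof -
  have p1: "p > 1" by (rule prime_gt_1_nat[OF p(1)])
  obtain P where P: "sylow_subgroup G p P"
    and Pmem: "\<And>u j. u \<in> carrier G \<Longrightarrow> ord u = p ^ j \<Longrightarrow> u \<in> P"
    using nilpotent_sylow_contains_primary[OF fin nil p(1)] by blast
  have PG: "subgroup P G" using P by (simp add: sylow_subgroup_def)
  interpret P: subgroup P G by (rule PG)
  have Pord: "\<exists>j. ord u = p ^ j" if u: "u \<in> P" for u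
  proof -
    have "card (generate G {u}) dvd card P"
      using u P.subset generate_subgroup_incl[OF _ PG, of "{u}"]
      by (intro card_subgroup_dvd_card_subgroup[OF generate_is_subgroup PG]) auto
    then have "ord u dvd p ^ multiplicity p (order G)"
      using generate_pow_card[OF P.mem_carrier[OF u]] P by (simp add: sylow_subgroup_def)
    then show ?thesis using divides_primepow_nat[OF p(1)] by blast
  qed
  define Y where "Y = {y \<in> P. x \<in> generate G {y}}"
  have "x \<in> Y" using x Pmem by (auto simp: Y_def generate.incl)
  moreover have "finite Y" using fin P.subset by (auto simp: Y_def intro: finite_subset)
  ultimately have "\<exists>y \<in> Y. \<forall>z \<in> Y. ord z \<le> ord y"
    using Max_in[of "ord ` Y"] Max_ge[of "ord ` Y"] by (metis (no_types, lifting) empty_iff finite_imageI image_iff)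
  then obtain y where y: "y \<in> P" "x \<in> generate G {y}"
    and max: "\<And>z. z \<in> P \<Longrightarrow> x \<in> generate G {z} \<Longrightarrow> ord z \<le> ord y"
    by (auto simp: Y_def)
  have yc: "y \<in> carrier G" by (rule P.mem_carrier[OF y(1)])
  obtain m where m: "ord y = p ^ m" using Pord[OF y(1)] by auto
  define H where "H = generate G {y}"
  have HG: "subgroup H G" using yc unfolding H_def by (intro generate_is_subgroup) auto
  interpret H: subgroup H G by (rule HG)
  have Hpow: "y [^] (i::nat) \<in> H" for i
    using generate_singleton_iff[OF fin yc] by (auto simp: H_def)
  have xH: "generate G {x} \<subseteq> H"
    using y(2) by (intro generate_subgroup_incl[OF _ HG]) (simp add: H_def)
  have HP: "H \<subset> P"
  proof -
    have "H \<subseteq> P" unfolding H_def using y(1) by (intro generate_subgroup_incl[OF _ PG]) auto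
    moreover have "H \<noteq> P"
      using noncyc[OF P] cyclic_group_generate_singleton[OF yc] by (auto simp: H_def)
    ultimately show ?thesis by auto
  qed
  have km: "k \<le> m"
  proof -
    have "card (generate G {x}) \<le> card H"
      using xH fin H.subset by (intro card_mono) (auto intro: finite_subset)
    then have "p ^ k \<le> p ^ m"
      using generate_pow_card[OF x(1)] generate_pow_card[OF yc] x m by (simp add: H_def)
    then show ?thesis using p1 by simp
  qed
  obtain h0 where h0: "h0 \<in> P" "h0 \<notin> H" "\<And>g. g \<in> H \<Longrightarrow> h0 \<otimes> g \<otimes> inv h0 \<in> H"
    using nilpotent_normalizer_grows[OF nil PG HG HP] by blast
  have h0c: "h0 \<in> carrier G" by (rule P.mem_carrier[OF h0(1)])
  have conj_pow: "h0 [^] (n::nat) \<otimes> g \<otimes> inv (h0 [^] n) \<in> H" if g: "g \<in> H" for n g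
  proof (induction n)
    case 0
    then show ?case using g H.mem_carrier[OF g] by simp
  next
    case (Suc n)
    have gc: "g \<in> carrier G" by (rule H.mem_carrier[OF g])
    have "h0 [^] Suc n \<otimes> g \<otimes> inv (h0 [^] Suc n) = h0 \<otimes> (h0 [^] n \<otimes> g \<otimes> inv (h0 [^] n)) \<otimes> inv h0"
      unfolding nat_pow_Suc2[OF h0c] using h0c gc by (simp add: inv_mult_group m_assoc)
    then show ?case using h0(3)[OF Suc] by simp
  qed
  obtain h where h: "h \<in> P" "h \<notin> H" "h [^] p \<in> H" "\<And>g. g \<in> H \<Longrightarrow> h \<otimes> g \<otimes> inv h \<in> H"
  proof -
    let ?A = "\<lambda>j. h0 [^] (p ^ j) \<in> H"
    obtain i where "ord h0 = p ^ i" using Pord[OF h0(1)] by auto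
    then have "?A i" using h0c H.one_closed by (metis pow_ord_eq_1)
    moreover have "\<not> ?A 0" using h0(2) h0c by simp
    ultimately obtain j where j: "\<not> ?A j" "?A (Suc j)"
      using nat_induct[of "\<lambda>j. \<not> ?A j" i] by blast
    show ?thesis
    proof (rule that[of "h0 [^] (p ^ j)"])
      have "h0 [^] n \<in> P" for n :: nat by (induction n) (auto intro: P.m_closed h0(1))
      then show "h0 [^] (p ^ j) \<in> P" .
      show "h0 [^] (p ^ j) \<notin> H" by (rule j(1))
      have "(h0 [^] (p ^ j)) [^] p = h0 [^] (p ^ Suc j)"
        using h0c by (simp add: nat_pow_pow mult.commute)
      then show "(h0 [^] (p ^ j)) [^] p \<in> H" using j(2) by simp
      show "\<And>g. g \<in> H \<Longrightarrow> h0 [^] (p ^ j) \<otimes> g \<otimes> inv (h0 [^] (p ^ j)) \<in> H" by (rule conj_pow)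
    qed
  qed
  have hc: "h \<in> carrier G" by (rule P.mem_carrier[OF h(1)])
  obtain r where r: "h \<otimes> y \<otimes> inv h = y [^] (r::nat)"
    using h(4)[OF Hpow[of 1]] generate_singleton_iff[OF fin yc] yc by (auto simp: H_def)
  have hy: "h \<otimes> y = y [^] r \<otimes> h"
    unfolding r[symmetric] using hc yc by (simp add: m_assoc)
  obtain s where s: "h [^] p = y [^] (s::nat)"
    using h(3) generate_singleton_iff[OF fin yc] by (auto simp: H_def)
  have m1: "m \<ge> 1" using km x(3) by simp
  \<comment> \<open>Otherwise \<open>y\<close> would be a power of \<open>h\<close>, against the maximality of the order of \<open>y\<close>.\<close>
  have "p dvd s"
  proof (rule ccontr)
    assume "\<not> p dvd s"
    then have "coprime s (p ^ m)" using p(1) by (simp add: coprime_commute prime_imp_coprime)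
    then obtain v where v: "[s * v = 1] (mod p ^ m)" using cong_solve_coprime_nat by (metis One_nat_def)
    have "(h [^] p) [^] v = y [^] (s * v)" using yc by (simp add: s nat_pow_pow)
    also have "\<dots> = y"
    proof -
      have "y [^] (s * v) = y [^] (1::nat)"
        using v m by (intro pow_eq_of_cong[OF yc]) simp
      then show ?thesis using yc by simp
    qed
    finally have yh: "y = h [^] (p * v)" using hc by (simp add: nat_pow_pow)
    have Kh: "subgroup (generate G {h}) G" using hc by (intro generate_is_subgroup) auto
    have "y \<in> generate G {h}" using yh generate_singleton_iff[OF fin hc] by blast
    then have sub: "H \<subseteq> generate G {h}" unfolding H_def by (intro generate_subgroup_incl[OF _ Kh]) auto
    have "ord h \<le> ord y" using max[OF h(1)] sub y(2) by (auto simp: H_def)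
    then have "card (generate G {h}) \<le> card H"
      using generate_pow_card[OF hc] generate_pow_card[OF yc] by (simp add: H_def)
    then have "H = generate G {h}"
      using sub fin subgroup.subset[OF Kh] by (intro card_seteq) (auto intro: finite_subset)
    then show False using h(2) generate.incl[of h "{h}" G] by simp
  qed
  then obtain s' where s': "s = p * s'" by auto
  \<comment> \<open>\<open>h ^ p\<close> is a power of \<open>y\<close>, so it commutes with \<open>y\<close> and \<open>r ^ p\<close> is \<open>1\<close> modulo \<open>p\<close>.\<close>
  have r1: "[r = 1] (mod p)"
  proof -
    have "h [^] p \<otimes> y = y [^] (r ^ p) \<otimes> h [^] p"
      using pow_conjugating[OF hc yc hy, of p 1] yc by simp
    then have "y [^] s \<otimes> y = y [^] (r ^ p) \<otimes> y [^] s" by (simp add: s)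
    then have "y [^] s \<otimes> y = y [^] s \<otimes> y [^] (r ^ p)" using yc by (simp add: nat_pow_comm)
    then have "y [^] (1::nat) = y [^] (r ^ p)" using yc by (metis Units_eq Units_l_cancel nat_pow_closed nat_pow_eone)
    then have "y [^] (int (r ^ p)) = y [^] (int 1)" by (metis int_pow_int)
    then have "int (p ^ m) dvd int 1 - int (r ^ p)" using int_pow_eq[OF yc] m by metis
    moreover have "int p dvd int (p ^ m)" using m1 by (simp add: dvd_power)
    ultimately have "int p dvd int 1 - int (r ^ p)" by (rule dvd_trans[rotated])
    then have rp: "[r ^ p = 1] (mod p)"
      by (metis cong_iff_dvd_diff cong_int_iff cong_sym)
    then have "\<not> p dvd r" using p1 by (metis cong_dvd_iff dvd_power prime_gt_0_nat p(1) nat_dvd_1_iff_1 less_irrefl dvd_trans)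
    from fermat_theorem[OF p(1) this] have "[r * r ^ (p - 1) = r * 1] (mod p)"
      by (intro cong_scalar_left)
    then have "[r ^ p = r] (mod p)" using p1 by (simp flip: power_Suc)
    then show ?thesis using rp by (metis cong_sym cong_trans)
  qed
  obtain u where u: "(\<Sum>i<p. r ^ i) = p * u" "coprime u p"
    using geometric_sum_mod_prime_square[OF p r1] by auto
  have "coprime u (p ^ m)" using u(2) by simp
  then obtain v where v: "[u * v = 1] (mod p ^ m)" using cong_solve_coprime_nat by (metis One_nat_def)
  \<comment> \<open>The exponent \<open>j\<close> is chosen such that the \<open>p\<close>-th power of \<open>y ^ j * h\<close>, which is
    \<open>y ^ (p * (j * u + s'))\<close>, becomes \<open>y ^ (p * p ^ (m - k))\<close>, an element of order \<open>p ^ (k - 1)\<close>. Here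
    \<open>p ^ m - 1\<close> stands for \<open>- 1\<close>.\<close>
  define j where "j = v * (p ^ (m - k) + s' * (p ^ m - 1))"
  have ju: "[j * u + s' = p ^ (m - k)] (mod p ^ m)"
  proof -
    have "[u * v * (p ^ (m - k) + s' * (p ^ m - 1)) + s' = 1 * (p ^ (m - k) + s' * (p ^ m - 1)) + s'] (mod p ^ m)"
      using v by (intro cong_add cong_mult cong_refl)
    also have "1 * (p ^ (m - k) + s' * (p ^ m - 1)) + s' = p ^ (m - k) + s' * p ^ m"
    proof -
      have "s' * (p ^ m - 1) + s' = s' * (p ^ m - 1 + 1)" by simp
      also have "p ^ m - 1 + 1 = p ^ m" using p1 by simp
      finally show ?thesis by simp
    qed
    also have "[\<dots> = p ^ (m - k)] (mod p ^ m)" by (simp add: cong_def)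
    finally show ?thesis by (simp add: j_def mult_ac)
  qed
  define w where "w = y [^] j \<otimes> h"
  have wc: "w \<in> carrier G" using yc hc by (simp add: w_def)
  have wH: "w \<notin> H"
  proof
    assume "w \<in> H"
    then have "inv (y [^] j) \<otimes> w \<in> H" using Hpow by auto
    then show False using h(2) yc hc by (simp add: w_def inv_mult_cancel)
  qed
  have wp: "w [^] p = y [^] (p * p ^ (m - k))"
  proof -
    have "w [^] p = y [^] (j * (\<Sum>i<p. r ^ i)) \<otimes> y [^] s"
      unfolding w_def pow_mult_conjugating[OF hc yc hy] s ..
    also have "\<dots> = y [^] (p * (j * u + s'))"
      using yc by (simp add: nat_pow_mult u(1) s' algebra_simps)
    also have "\<dots> = y [^] (p * p ^ (m - k))"
    proof -
      have "[p * (j * u + s') = p * p ^ (m - k)] (mod p ^ m)" using ju by (rule cong_scalar_left)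
      then show ?thesis using m by (intro pow_eq_of_cong[OF yc]) simp
    qed
    finally show ?thesis .
  qed
  have ord_w: "ord w = p ^ k"
  proof -
    have pk: "(w [^] (p::nat)) [^] (p ^ i) = y [^] (p ^ (m - k + 1 + i))" for i
      using yc by (simp add: wp nat_pow_pow power_add mult_ac)
    have "w [^] (p ^ k) = \<one>"
    proof -
      have "w [^] (p ^ k) = (w [^] p) [^] (p ^ (k - 1))"
        using wc x(3) by (simp add: nat_pow_pow flip: power_Suc)
      also have "\<dots> = y [^] (p ^ m)" unfolding pk using km x(3) by simp
      also have "\<dots> = \<one>" using yc m by (metis pow_ord_eq_1)
      finally show ?thesis .
    qed
    then have "ord w dvd p ^ k" using wc pow_eq_id by blast
    then obtain i where i: "i \<le> k" "ord w = p ^ i" using divides_primepow_nat[OF p(1)] by blast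
    have "i = k"
    proof (rule ccontr)
      assume "i \<noteq> k"
      then have ik: "i < k" using i by simp
      show False
      proof (cases i)
        case 0
        then have "w = \<one>" using i(2) wc ord_eq_1 by simp
        then show False using wH H.one_closed by simp
      next
        case (Suc i')
        have "\<one> = w [^] (p ^ i)" using i(2) wc by (metis pow_ord_eq_1)
        also have "\<dots> = (w [^] p) [^] (p ^ i')" using wc Suc by (simp add: nat_pow_pow)
        also have "\<dots> = y [^] (p ^ (m - k + i))" unfolding pk Suc by simp
        finally have "p ^ m dvd p ^ (m - k + i)" using m pow_eq_id[OF yc] by metis
        then have "m \<le> m - k + i" using p1 by (simp add: dvd_power_iff_le)
        then show False using ik km by simp
      qed
    qed
    then show ?thesis using i by simp
  qed
  show ?thesis using wc ord_w wH xH by blast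
qed

section \<open>Cocyclic elements and primary parts\<close>

text \<open>Membership in a common cyclic subgroup: the reflexive closure of adjacency in the enhanced power
  graph.\<close>

definition (in group) cocyclic :: "'a \<Rightarrow> 'a \<Rightarrow> bool" where
  "cocyclic x y \<longleftrightarrow> (\<exists>z \<in> carrier G. x \<in> generate G {z} \<and> y \<in> generate G {z})"

text \<open>Exponents \<open>a\<close> and \<open>b\<close> such that, for all \<open>x\<close> at once, \<open>x ^ a\<close> is the \<open>p\<close>-part of \<open>x\<close> and \<open>x ^ b\<close>
  is its part of order prime to \<open>p\<close>.\<close>

definition (in group) primary_exponents :: "nat \<Rightarrow> nat \<Rightarrow> nat \<Rightarrow> bool" where
  "primary_exponents p a b \<longleftrightarrow>
     (let q = p ^ multiplicity p (order G) in
        [a = 1] (mod q) \<and> [a = 0] (mod order G div q) \<and>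
        [b = 0] (mod q) \<and> [b = 1] (mod order G div q))"

locale finite_group = group +
  assumes finite_carrier: "finite (carrier G)"
begin

lemma ord_pos: "x \<in> carrier G \<Longrightarrow> ord x > 0"
  using ord_ge_1[OF finite_carrier] by fastforce

lemma generate_iff: "y \<in> carrier G \<Longrightarrow> z \<in> generate G {y} \<longleftrightarrow> (\<exists>k::nat. z = y [^] k)"
  by (rule generate_singleton_iff[OF finite_carrier])

lemma generate_singleton_mono:
  assumes "y \<in> carrier G" "w \<in> generate G {y}"
  shows "generate G {w} \<subseteq> generate G {y}"
  using assms by (intro generate_subgroup_incl generate_is_subgroup) auto

lemma mem_generate_if_ord_dvd:
  assumes z: "z \<in> carrier G" and u: "u \<in> generate G {z}" and w: "w \<in> generate G {z}"
    and dvd: "ord w dvd ord u"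
  shows "w \<in> generate G {u}"
proof -
  obtain i where i: "u = z [^] (i::nat)" using u generate_iff[OF z] by auto
  obtain j where j: "w = z [^] (j::nat)" using w generate_iff[OF z] by auto
  have uc: "u \<in> carrier G" and wc: "w \<in> carrier G" using z by (simp_all add: i j)
  define N where "N = ord z"
  have N: "N > 0" using ord_pos[OF z] by (simp add: N_def)
  define g where "g = gcd N i"
  have g: "g > 0" "g dvd N" using N by (auto simp: g_def)
  have ordu: "ord u = N div g"
    using ord_pow_gen[OF z, of i] N by (auto simp: i g_def N_def)
  have "w [^] (N div g) = \<one>"
    using dvd ordu pow_eq_id[OF wc] by simp
  then have "N dvd j * (N div g)"
    using z pow_eq_id[OF z] by (simp add: j nat_pow_pow N_def)
  then have "g * (N div g) dvd j * (N div g)" using g by simp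
  moreover have "N div g > 0" using g N by (simp add: dvd_imp_le div_greater_zero_iff)
  ultimately have "g dvd j" by simp
  then obtain t where t: "j = g * t" by auto
  have "\<exists>a. [i * a = g] (mod N)"
  proof (cases "i = 0")
    case True
    then show ?thesis by (auto simp: g_def cong_def)
  next
    case False
    then show ?thesis using cong_solve_nat[of i N] by (simp add: g_def gcd.commute)
  qed
  then obtain a where "[i * a = g] (mod N)" by auto
  then have "[i * a * t = g * t] (mod N)" by (rule cong_scalar_right)
  then have "z [^] (i * a * t) = z [^] j" using z by (intro pow_eq_of_cong) (simp_all add: N_def t)
  then have "w = u [^] (a * t)" using z by (simp add: i j nat_pow_pow mult.assoc)
  then show ?thesis using generate_iff[OF uc] by blast
qed

lemma cocyclic_commute: "cocyclic x y \<Longrightarrow> cocyclic y x"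
  by (auto simp: cocyclic_def)

lemma cocyclic_pow:
  assumes "cocyclic x y"
  shows "cocyclic (x [^] (m::nat)) (y [^] (n::nat))"
proof -
  obtain z where z: "z \<in> carrier G" "x \<in> generate G {z}" "y \<in> generate G {z}"
    using assms by (auto simp: cocyclic_def)
  have "x [^] m \<in> generate G {z}" "y [^] n \<in> generate G {z}"
    using z generate_iff[OF z(1)] by (auto simp: nat_pow_pow)
  then show ?thesis using z(1) by (auto simp: cocyclic_def)
qed

lemma not_cocyclic_if_not_mem_generate:
  assumes "ord w dvd ord u" "w \<notin> generate G {u}"
  shows "\<not> cocyclic u w"
  using assms mem_generate_if_ord_dvd by (auto simp: cocyclic_def)

lemma generate_eq_if_ord_eq:
  assumes u: "u \<in> carrier G" and w: "w \<in> generate G {u}" and eq: "ord w = ord u"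
  shows "generate G {w} = generate G {u}"
proof -
  have wc: "w \<in> carrier G" using u w generate_incl[of "{u}"] by auto
  have "finite (generate G {u})"
    using u finite_carrier generate_incl[of "{u}"] by (auto intro: finite_subset)
  then show ?thesis
    using generate_singleton_mono[OF u w] generate_pow_card[OF u] generate_pow_card[OF wc] eq
    by (intro card_seteq) auto
qed

lemma card_generators:
  assumes u: "u \<in> carrier G"
  shows "card {v \<in> carrier G. generate G {v} = generate G {u}} = card {j. j < ord u \<and> coprime (ord u) j}"
proof -
  let ?J = "{j. j < ord u \<and> coprime (ord u) j}" and ?f = "\<lambda>j::nat. u [^] j"
  have ordj: "ord (u [^] j) = ord u div gcd (ord u) j" for j :: nat
    using ord_pow_gen[OF u, of j] ord_pos[OF u] by auto
  have "inj_on ?f ?J"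
  proof (rule inj_onI)
    fix i j assume ij: "i \<in> ?J" "j \<in> ?J" "u [^] i = u [^] j"
    then have "int (ord u) dvd int j - int i"
      using int_pow_eq[OF u, of "int i" "int j"] by (simp add: int_pow_int)
    then have "[i = j] (mod ord u)" by (metis cong_iff_dvd_diff cong_int_iff cong_sym)
    then show "i = j" using ij(1,2) by (auto simp: cong_def)
  qed
  moreover have "?f ` ?J = {v \<in> carrier G. generate G {v} = generate G {u}}"
  proof (intro equalityI subsetI)
    fix v assume "v \<in> ?f ` ?J"
    then obtain j where j: "v = u [^] j" "coprime (ord u) j" by auto
    then have "ord v = ord u" using ordj[of j] by simp
    moreover have "v \<in> generate G {u}" using j generate_iff[OF u] by auto
    ultimately show "v \<in> {v \<in> carrier G. generate G {v} = generate G {u}}"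
      using generate_eq_if_ord_eq[OF u] u j by auto
  next
    fix v assume "v \<in> {v \<in> carrier G. generate G {v} = generate G {u}}"
    then have v: "v \<in> carrier G" "generate G {v} = generate G {u}" by auto
    then have "v \<in> generate G {u}" by (metis generate.incl singletonI)
    then obtain i where i: "v = u [^] (i::nat)" using generate_iff[OF u] by auto
    define j where "j = i mod ord u"
    have j: "v = u [^] j" "j < ord u"
      using ord_pos[OF u] by (auto simp: i j_def cong_def intro!: pow_eq_of_cong[OF u])
    have "ord v = ord u" using v generate_pow_card u by metis
    then have "ord u div gcd (ord u) j = ord u" using ordj[of j] j by simp
    then have "gcd (ord u) j = 1"
      using ord_pos[OF u] by (metis div_eq_dividend_iff)
    then show "v \<in> ?f ` ?J" using j by (auto simp: coprime_iff_gcd_eq_1)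
  qed
  ultimately show ?thesis by (metis card_image)
qed

lemma primary_exponents_exist:
  assumes p: "Factorial_Ring.prime p"
  shows "\<exists>a b. primary_exponents p a b"
proof -
  let ?q = "p ^ multiplicity p (order G)" and ?M = "order G div p ^ multiplicity p (order G)"
  have "order G \<noteq> 0" using finite_carrier by (metis less_not_refl order_gt_0_iff_finite)
  then have "\<not> p dvd ?M" using p by (intro multiplicity_decompose) auto
  then have "coprime ?q ?M" using p by (simp add: prime_imp_coprime)
  then show ?thesis
    unfolding primary_exponents_def Let_def
    using binary_chinese_remainder_nat[of ?q ?M 1 0] binary_chinese_remainder_nat[of ?q ?M 0 1] by blast
qed

context
  fixes p a b :: nat
  assumes p: "Factorial_Ring.prime p" and ab: "primary_exponents p a b"
begin

lemma primary_parts_mult: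
  assumes x: "x \<in> carrier G"
  shows "x [^] a \<otimes> x [^] b = x"
proof -
  let ?q = "p ^ multiplicity p (order G)" and ?M = "order G div p ^ multiplicity p (order G)"
  have og: "order G \<noteq> 0" using finite_carrier by (metis less_not_refl order_gt_0_iff_finite)
  then have "\<not> p dvd ?M" using p by (intro multiplicity_decompose) auto
  then have "coprime ?q ?M" using p by (simp add: prime_imp_coprime)
  moreover have "[a + b = 1 + 0] (mod ?q)" "[a + b = 0 + 1] (mod ?M)"
    using ab unfolding primary_exponents_def Let_def by (blast intro: cong_add)+
  ultimately have "[a + b = 1] (mod ?q * ?M)" by (simp add: coprime_cong_mult_nat)
  also have "?q * ?M = order G" by (simp add: multiplicity_dvd)
  finally have "[a + b = 1] (mod ord x)"
    using ord_dvd_group_order[OF x] cong_dvd_modulus_nat by blast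
  then have "x [^] (a + b) = x [^] (1::nat)" by (rule pow_eq_of_cong[OF x])
  then show ?thesis using x by (simp add: nat_pow_mult)
qed

lemma ord_primary_part:
  assumes x: "x \<in> carrier G"
  shows "\<exists>k \<le> multiplicity p (order G). ord (x [^] a) = p ^ k"
proof -
  let ?q = "p ^ multiplicity p (order G)" and ?M = "order G div p ^ multiplicity p (order G)"
  have "?M dvd a" using ab by (simp add: primary_exponents_def Let_def cong_0_iff)
  then have "?q * ?M dvd a * ?q" by (simp add: mult.commute)
  also have "?q * ?M = order G" by (simp add: multiplicity_dvd)
  finally have "ord x dvd a * ?q" using ord_dvd_group_order[OF x] dvd_trans by blast
  then have "(x [^] a) [^] ?q = \<one>" using x pow_eq_id[OF x] by (simp add: nat_pow_pow)
  then have "ord (x [^] a) dvd ?q" using x pow_eq_id[of "x [^] a"] by simp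
  then show ?thesis using divides_primepow_nat[OF p] by blast
qed

lemma ord_coprimary_part:
  assumes x: "x \<in> carrier G"
  shows "\<not> p dvd ord (x [^] b)"
proof -
  let ?q = "p ^ multiplicity p (order G)" and ?M = "order G div p ^ multiplicity p (order G)"
  have og: "order G \<noteq> 0" using finite_carrier by (metis less_not_refl order_gt_0_iff_finite)
  then have pM: "\<not> p dvd ?M" using p by (intro multiplicity_decompose) auto
  have "?q dvd b" using ab by (simp add: primary_exponents_def Let_def cong_0_iff)
  then have "?q * ?M dvd b * ?M" by (rule mult_dvd_mono) simp
  also have "?q * ?M = order G" by (simp add: multiplicity_dvd)
  finally have "ord x dvd b * ?M" using ord_dvd_group_order[OF x] dvd_trans by blast
  then have "(x [^] b) [^] ?M = \<one>" using x pow_eq_id[OF x] by (simp add: nat_pow_pow)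
  then have "ord (x [^] b) dvd ?M" using x pow_eq_id[of "x [^] b"] by simp
  then show ?thesis using pM dvd_trans by blast
qed

lemma primary_element_parts:
  assumes x: "x \<in> carrier G" and ord: "ord x = p ^ k"
  shows "x [^] a = x" and "x [^] b = \<one>"
proof -
  let ?q = "p ^ multiplicity p (order G)"
  have og: "order G \<noteq> 0" using finite_carrier by (metis less_not_refl order_gt_0_iff_finite)
  have "p ^ k dvd order G" using ord_dvd_group_order[OF x] ord by simp
  then have "k \<le> multiplicity p (order G)" using og p by (intro multiplicity_geI) auto
  then have q: "ord x dvd ?q" unfolding ord by (rule le_imp_power_dvd)
  have "[a = 1] (mod ord x)" "[b = 0] (mod ord x)"
    using ab q cong_dvd_modulus_nat unfolding primary_exponents_def Let_def by blast+
  then have "x [^] a = x [^] (1::nat)" "x [^] b = x [^] (0::nat)"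
    using pow_eq_of_cong[OF x] by blast+
  then show "x [^] a = x" and "x [^] b = \<one>" using x by simp_all
qed

lemma coprimary_element_parts:
  assumes x: "x \<in> carrier G" and ord: "\<not> p dvd ord x"
  shows "x [^] a = \<one>" and "x [^] b = x"
proof -
  let ?q = "p ^ multiplicity p (order G)" and ?M = "order G div p ^ multiplicity p (order G)"
  have "coprime (ord x) ?q" using p ord by (simp add: coprime_commute prime_imp_coprime)
  moreover have "ord x dvd ?q * ?M" using ord_dvd_group_order[OF x] by (simp add: multiplicity_dvd)
  ultimately have M: "ord x dvd ?M" by (simp add: coprime_dvd_mult_right_iff)
  have "[a = 0] (mod ord x)" "[b = 1] (mod ord x)"
    using ab M cong_dvd_modulus_nat unfolding primary_exponents_def Let_def by blast+
  then have "x [^] a = x [^] (0::nat)" "x [^] b = x [^] (1::nat)"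
    using pow_eq_of_cong[OF x] by blast+
  then show "x [^] a = \<one>" and "x [^] b = x" using x by simp_all
qed

lemma parts_of_commuting_product:
  assumes u: "u \<in> carrier G" "ord u = p ^ k" and s: "s \<in> carrier G" "\<not> p dvd ord s"
    and comm: "u \<otimes> s = s \<otimes> u"
  shows "(u \<otimes> s) [^] a = u" and "(u \<otimes> s) [^] b = s"
  using u s pow_mult_distrib[OF comm u(1) s(1)] primary_element_parts[OF u]
    coprimary_element_parts[OF s] by simp_all

lemma primary_part_eq_one_iff:
  assumes x: "x \<in> carrier G"
  shows "x [^] a = \<one> \<longleftrightarrow> \<not> p dvd ord x"
proof
  assume "x [^] a = \<one>"
  then have "x [^] b = x" using primary_parts_mult[OF x] x by simp
  then show "\<not> p dvd ord x" using ord_coprimary_part[OF x] by simp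
qed (use coprimary_element_parts[OF x] in auto)

end

end

section \<open>Hamiltonian paths of non-cocyclic elements\<close>

text \<open>The properties of \<open>G\<close> on which the construction of the path rests. \<open>A\<close> is a finite set of primes
  for which \<open>p\<close>-elements commute with the elements of order prime to \<open>p\<close>, and for which no cyclic
  subgroup of order \<open>p ^ k\<close>, \<open>k \<ge> 1\<close>, is the only one of its order.\<close>

locale primary_noncyclic_group = finite_group +
  fixes A :: "nat set"
  assumes finite_primes: "finite A"
    and prime_A: "p \<in> A \<Longrightarrow> Factorial_Ring.prime p"
    and primary_commute: "\<lbrakk>p \<in> A; x \<in> carrier G; y \<in> carrier G; ord x = p ^ k; \<not> p dvd ord y\<rbrakk>
      \<Longrightarrow> x \<otimes> y = y \<otimes> x"
    and second_primary: "\<lbrakk>p \<in> A; x \<in> carrier G; ord x = p ^ k; k \<ge> 1\<rbrakk>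
      \<Longrightarrow> \<exists>w \<in> carrier G. ord w = p ^ k \<and> w \<notin> generate G {x}"
begin

text \<open>The elements whose order is divisible by no prime of \<open>A\<close> other than those in \<open>\<pi>\<close>. Primes
  outside \<open>A\<close> are not restricted.\<close>

definition prime_support :: "nat set \<Rightarrow> 'a set" where
  "prime_support \<pi> = {x \<in> carrier G. \<forall>p \<in> A - \<pi>. \<not> p dvd ord x}"

lemma prime_support_subset: "prime_support \<pi> \<subseteq> carrier G"
  by (auto simp: prime_support_def)

lemma finite_prime_support: "finite (prime_support \<pi>)"
  using finite_carrier prime_support_subset by (rule finite_subset[rotated])

lemma one_in_prime_support: "\<one> \<in> prime_support \<pi>"
proof -
  have "1 \<notin> A" using prime_A[of 1] by (metis not_prime_1)
  then show ?thesis by (auto simp: prime_support_def)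
qed

lemma primary_in_prime_support:
  assumes "u \<in> carrier G" "ord u = p ^ k" "p \<in> A" "p \<in> \<pi>"
  shows "u \<in> prime_support \<pi>"
proof -
  have "\<not> q dvd p ^ k" if "q \<in> A - \<pi>" for q
    using that assms(3,4) prime_A by (metis DiffE prime_dvd_power primes_dvd_imp_eq)
  then show ?thesis using assms by (simp add: prime_support_def)
qed

lemma not_cocyclic_partner:
  assumes r: "r \<in> prime_support \<pi> - prime_support {}"
  shows "\<exists>s \<in> prime_support \<pi>. \<not> cocyclic r s"
proof -
  have rc: "r \<in> carrier G" using r by (simp add: prime_support_def)
  obtain q where q: "q \<in> A" "q \<in> \<pi>" "q dvd ord r" using r by (auto simp: prime_support_def)
  have qp: "Factorial_Ring.prime q" by (rule prime_A[OF q(1)])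
  obtain a b where ab: "primary_exponents q a b" using primary_exponents_exist[OF qp] by auto
  obtain k where k: "ord (r [^] a) = q ^ k" using ord_primary_part[OF qp ab rc] by auto
  have ra: "r [^] a \<in> carrier G" using rc by simp
  have "r [^] a \<noteq> \<one>" using primary_part_eq_one_iff[OF qp ab rc] q by simp
  then have "k \<ge> 1" using k ord_eq_1[OF ra] by (cases k) auto
  then obtain w where w: "w \<in> carrier G" "ord w = q ^ k" "w \<notin> generate G {r [^] a}"
    using second_primary[OF q(1) ra k] by blast
  have "\<not> cocyclic (r [^] a) w" using w k by (intro not_cocyclic_if_not_mem_generate) auto
  then have "\<not> cocyclic r w" using cocyclic_pow[of r w a 1] w(1) by auto
  then show ?thesis using primary_in_prime_support[OF w(1,2) q(1,2)] by blast
qed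

context
  fixes p a b :: nat and \<pi> :: "nat set"
  assumes pA: "p \<in> A" and p\<pi>: "p \<notin> \<pi>" and ab: "primary_exponents p a b"
begin

lemmas pp = prime_A[OF pA]

lemma product_in_prime_support:
  assumes u: "u \<in> carrier G" "ord u = p ^ k" and s: "s \<in> prime_support \<pi>"
  shows "u \<otimes> s \<in> prime_support (insert p \<pi>)"
    and "(u \<otimes> s) [^] a = u" and "(u \<otimes> s) [^] b = s"
proof -
  have sc: "s \<in> carrier G" and ps: "\<not> p dvd ord s" using s pA p\<pi> by (auto simp: prime_support_def)
  have comm: "u \<otimes> s = s \<otimes> u" by (rule primary_commute[OF pA u(1) sc u(2) ps])
  show "(u \<otimes> s) [^] a = u" "(u \<otimes> s) [^] b = s"
    by (rule parts_of_commuting_product[OF pp ab u sc ps comm])+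
  have "\<not> q dvd ord (u \<otimes> s)" if q: "q \<in> A - insert p \<pi>" for q
  proof
    have qp: "Factorial_Ring.prime q" using prime_A q by auto
    assume "q dvd ord (u \<otimes> s)"
    then have "q dvd p ^ k * ord s" using ord_mul_divides[OF comm u(1) sc] u(2) dvd_trans by metis
    then have "q dvd p ^ k \<or> q dvd ord s" using qp prime_dvd_mult_iff by blast
    moreover have "\<not> q dvd p ^ k" using q qp pp by (metis DiffE insertI1 prime_dvd_power primes_dvd_imp_eq)
    ultimately show False using q s by (auto simp: prime_support_def)
  qed
  then show "u \<otimes> s \<in> prime_support (insert p \<pi>)" using u(1) sc by (auto simp: prime_support_def)
qed

lemma coprimary_part_in_prime_support:
  assumes x: "x \<in> prime_support (insert p \<pi>)"
  shows "x [^] b \<in> prime_support \<pi>"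
proof -
  have xc: "x \<in> carrier G" using x by (simp add: prime_support_def)
  have "(x [^] b) [^] ord x = (x [^] ord x) [^] b"
    using xc by (simp add: nat_pow_pow mult.commute del: pow_ord_eq_1)
  then have "ord (x [^] b) dvd ord x" using xc pow_eq_id[of "x [^] b" "ord x"] by simp
  then have "\<not> q dvd ord (x [^] b)" if "q \<in> A - \<pi>" for q
    using that x ord_coprimary_part[OF pp ab xc] dvd_trans by (cases "q = p") (auto simp: prime_support_def)
  then show ?thesis using xc by (auto simp: prime_support_def)
qed

text \<open>The elements whose \<open>p\<close>-part has order \<open>p ^ k\<close>, all other primes of \<open>A\<close> that divide their
  order being in \<open>\<pi>\<close>.\<close>

definition level :: "nat \<Rightarrow> 'a set" where
  "level k = {x \<in> prime_support (insert p \<pi>). ord (x [^] a) = p ^ k}"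

text \<open>An element of the level is a unique product of an element \<open>v\<close> of order \<open>p ^ k\<close> and an
  element of the support of \<open>\<pi>\<close>; its class is determined by \<open>v\<close>. So all classes are equally
  large.\<close>

lemma card_level_fiber:
  assumes u: "u \<in> carrier G" "ord u = p ^ k"
  shows "card {x \<in> level k. generate G {x [^] a} = generate G {u}}
    = card {j. j < p ^ k \<and> coprime (p ^ k) j} * card (prime_support \<pi>)"
proof -
  let ?U = "{v \<in> carrier G. generate G {v} = generate G {u}}" and ?f = "\<lambda>(v, s). v \<otimes> s"
  have ordU: "ord v = p ^ k" if "v \<in> ?U" for v
    using that u generate_pow_card by (metis (mono_tags, lifting) mem_Collect_eq)
  have parts: "(v \<otimes> s) [^] a = v" "(v \<otimes> s) [^] b = s" if "v \<in> ?U" "s \<in> prime_support \<pi>" for v s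
    using product_in_prime_support(2,3)[OF _ ordU[OF that(1)] that(2)] that(1) by auto
  have inj: "inj_on ?f (?U \<times> prime_support \<pi>)"
  proof (rule inj_onI)
    fix y z assume yz: "y \<in> ?U \<times> prime_support \<pi>" "z \<in> ?U \<times> prime_support \<pi>" "?f y = ?f z"
    obtain v s v' s' where *: "y = (v, s)" "z = (v', s')" by (cases y, cases z)
    then have "(v \<otimes> s) [^] a = (v' \<otimes> s') [^] a" "(v \<otimes> s) [^] b = (v' \<otimes> s') [^] b"
      using yz(3) by simp_all
    then show "y = z" using parts[of v s] parts[of v' s'] yz(1,2) * by auto
  qed
  have img: "?f ` (?U \<times> prime_support \<pi>) = {x \<in> level k. generate G {x [^] a} = generate G {u}}"
  proof (intro equalityI subsetI)
    fix x assume "x \<in> ?f ` (?U \<times> prime_support \<pi>)"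
    then obtain v s where vs: "x = v \<otimes> s" "v \<in> ?U" "s \<in> prime_support \<pi>" by auto
    then show "x \<in> {x \<in> level k. generate G {x [^] a} = generate G {u}}"
      using parts[OF vs(2,3)] ordU[OF vs(2)] product_in_prime_support(1)[OF _ ordU[OF vs(2)] vs(3)]
      by (auto simp: level_def)
  next
    fix x assume x: "x \<in> {x \<in> level k. generate G {x [^] a} = generate G {u}}"
    then have xc: "x \<in> carrier G" using prime_support_subset by (auto simp: level_def)
    have "x = ?f (x [^] a, x [^] b)" using primary_parts_mult[OF pp ab xc] by simp
    moreover have "x [^] b \<in> prime_support \<pi>"
      using x by (intro coprimary_part_in_prime_support) (auto simp: level_def)
    moreover have "x [^] a \<in> ?U" using x xc by auto
    ultimately show "x \<in> ?f ` (?U \<times> prime_support \<pi>)" by blast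
  qed
  have "card {x \<in> level k. generate G {x [^] a} = generate G {u}} = card (?U \<times> prime_support \<pi>)"
    unfolding img[symmetric] by (rule card_image[OF inj])
  then show ?thesis using card_generators[OF u(1)] u(2) by (simp add: card_cartesian_product)
qed

lemma not_cocyclic_if_primary_part_not_mem:
  assumes "x \<in> carrier G" "y \<in> carrier G" "ord (x [^] a) = p ^ k" "ord (y [^] a) = p ^ l" "l \<le> k"
    and "y [^] a \<notin> generate G {x [^] a}"
  shows "\<not> cocyclic x y"
proof -
  have "ord (y [^] a) dvd ord (x [^] a)" using assms(3-5) by (simp add: le_imp_power_dvd)
  then have "\<not> cocyclic (x [^] a) (y [^] a)" using assms(6) by (rule not_cocyclic_if_not_mem_generate)
  then show ?thesis using cocyclic_pow by blast
qed

text \<open>The path starts in the class of a prescribed \<open>u\<close>, and the part prime to \<open>p\<close> of its last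
  element is prescribed.\<close>

lemma level_path:
  assumes u: "u \<in> carrier G" "ord u = p ^ k" and k: "k \<ge> 1" and s: "s \<in> prime_support \<pi>"
  shows "\<exists>ys w. distinct ys \<and> set ys = level k \<and> successively (\<lambda>x y. \<not> cocyclic x y) ys \<and>
    ys \<noteq> [] \<and> generate G {hd ys [^] a} = generate G {u} \<and>
    w \<in> carrier G \<and> ord w = p ^ k \<and> last ys = w \<otimes> s"
proof -
  let ?c = "\<lambda>x. generate G {x [^] a}"
  obtain w where w: "w \<in> carrier G" "ord w = p ^ k" "w \<notin> generate G {u}"
    using second_primary[OF pA u k] by blast
  note one = one_in_prime_support[of \<pi>]
  have ul: "u \<in> level k" "?c u = generate G {u}"
    using product_in_prime_support[OF u one] u by (auto simp: level_def)
  have wl: "w \<otimes> s \<in> level k" "?c (w \<otimes> s) = generate G {w}"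
    using product_in_prime_support[OF w(1,2) s] w by (auto simp: level_def)
  have ne: "generate G {w} \<noteq> generate G {u}" using w(3) by (metis generate.incl singletonI)
  have lc: "x \<in> carrier G" "ord (x [^] a) = p ^ k" if "x \<in> level k" for x
    using that prime_support_subset by (auto simp: level_def)
  have fin: "finite (level k)" using finite_prime_support by (auto simp: level_def)
  have "card {x \<in> level k. ?c x = i} = card {j. j < p ^ k \<and> coprime (p ^ k) j} * card (prime_support \<pi>)"
    if i: "i \<in> ?c ` level k" for i
  proof -
    obtain x where "x \<in> level k" "i = ?c x" using i by auto
    then show ?thesis using card_level_fiber[of "x [^] a" k] lc by simp
  qed
  from balanced_multipartite_path[OF fin this _ wl(1), of "generate G {u}"] ul wl ne
  obtain ys where ys: "distinct ys" "set ys = level k" "successively (\<lambda>x y. ?c x \<noteq> ?c y) ys"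
      "ys \<noteq> []" "?c (hd ys) = generate G {u}" "last ys = w \<otimes> s"
    by (metis (no_types, lifting) image_eqI)
  have "successively (\<lambda>x y. \<not> cocyclic x y) ys"
  proof (rule successively_mono[OF ys(3)])
    fix x y assume xy: "x \<in> set ys" "y \<in> set ys" "?c x \<noteq> ?c y"
    then have *: "x \<in> carrier G" "ord (x [^] a) = p ^ k" "y \<in> carrier G" "ord (y [^] a) = p ^ k"
      using ys(2) lc by auto
    have "y [^] a \<notin> ?c x"
      using generate_eq_if_ord_eq[of "x [^] a" "y [^] a"] * xy(3) by auto
    then show "\<not> cocyclic x y"
      using * by (intro not_cocyclic_if_primary_part_not_mem[of x y k k]) auto
  qed
  then show ?thesis using ys w(1,2) by blast
qed

text \<open>The levels \<open>i \<ge> k\<close> are visited from the highest to the lowest. This direction makes the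
  links easy: the last element of the path so far has a \<open>p\<close>-part of order \<open>p ^ Suc k\<close>, and among
  two distinct cyclic subgroups of order \<open>p ^ k\<close> at least one is not contained in the subgroup that
  this \<open>p\<close>-part generates.\<close>

lemma upper_levels_path:
  assumes s: "s \<in> prime_support \<pi>" and k: "k \<ge> 1" "k \<le> Suc (multiplicity p (order G))"
  shows "\<exists>xs. distinct xs \<and> set xs = (\<Union>i\<in>{k..}. level i) \<and>
    successively (\<lambda>x y. \<not> cocyclic x y) xs \<and>
    (xs \<noteq> [] \<longrightarrow> (\<exists>w \<in> carrier G. ord w = p ^ k \<and> last xs = w \<otimes> s))"
  using k(2,1)
proof (induction k rule: inc_induct)
  case base
  have "level i = {}" if "i \<ge> Suc (multiplicity p (order G))" for i
  proof (rule ccontr)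
    assume "level i \<noteq> {}"
    then obtain x where x: "x \<in> carrier G" "ord (x [^] a) = p ^ i"
      using prime_support_subset by (auto simp: level_def)
    obtain j where "j \<le> multiplicity p (order G)" "ord (x [^] a) = p ^ j"
      using ord_primary_part[OF pp ab x(1)] by auto
    then show False using x(2) that prime_gt_1_nat[OF pp] by (simp add: power_inject_exp)
  qed
  then have "(\<Union>i\<in>{Suc (multiplicity p (order G))..}. level i) = {}" by auto
  then show ?case by (intro exI[of _ "[]"]) simp
next
  case (step k)
  obtain xs where xs: "distinct xs" "set xs = (\<Union>i\<in>{Suc k..}. level i)"
      "successively (\<lambda>x y. \<not> cocyclic x y) xs"
      "xs \<noteq> [] \<longrightarrow> (\<exists>w \<in> carrier G. ord w = p ^ Suc k \<and> last xs = w \<otimes> s)"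
    using step.IH by auto
  have "{k..} = insert k {Suc k..}" by auto
  then have split: "(\<Union>i\<in>{k..}. level i) = (\<Union>i\<in>{Suc k..}. level i) \<union> level k"
    by (simp add: Un_commute)
  have disj: "(\<Union>i\<in>{Suc k..}. level i) \<inter> level k = {}"
    using prime_gt_1_nat[OF pp] by (auto simp: level_def power_inject_exp)
  show ?case
  proof (cases "\<exists>u \<in> carrier G. ord u = p ^ k")
    case False
    have "x \<notin> level i" if "i \<ge> k" for x i
    proof
      assume "x \<in> level i"
      then have x: "x [^] a \<in> carrier G" "ord (x [^] a) = p ^ i"
        using prime_support_subset by (auto simp: level_def)
      have "ord ((x [^] a) [^] (p ^ (i - k))) = p ^ i div p ^ (i - k)"
        using ord_pow[OF x(1), of "p ^ (i - k)"] x(2) prime_gt_0_nat[OF pp] by (simp add: le_imp_power_dvd)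
      also have "\<dots> = p ^ k" using that prime_gt_0_nat[OF pp] by (simp flip: power_diff)
      finally show False using False x(1) by (metis nat_pow_closed)
    qed
    then have "(\<Union>i\<in>{k..}. level i) = {}" by auto
    then show ?thesis by (intro exI[of _ "[]"]) simp
  next
    case True
    then obtain u1 where u1: "u1 \<in> carrier G" "ord u1 = p ^ k" by auto
    have "\<exists>u \<in> carrier G. ord u = p ^ k \<and> (xs \<noteq> [] \<longrightarrow> u \<notin> generate G {last xs [^] a})"
    proof (cases "xs = []")
      case True
      then show ?thesis using u1 by auto
    next
      case False
      then have "last xs \<in> carrier G"
        using xs(2) prime_support_subset last_in_set[OF False] by (auto simp: level_def)
      then have lc: "last xs [^] a \<in> carrier G" by simp
      obtain u2 where u2: "u2 \<in> carrier G" "ord u2 = p ^ k" "u2 \<notin> generate G {u1}"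
        using second_primary[OF pA u1 step.prems] by blast
      show ?thesis
      proof (cases "u1 \<in> generate G {last xs [^] a}")
        case True
        then have "u2 \<notin> generate G {last xs [^] a}"
          using mem_generate_if_ord_dvd[OF lc True, of u2] u1 u2 by auto
        then show ?thesis using u2 by auto
      qed (use u1 in auto)
    qed
    then obtain u where u: "u \<in> carrier G" "ord u = p ^ k"
        "xs \<noteq> [] \<Longrightarrow> u \<notin> generate G {last xs [^] a}" by auto
    obtain ys w where ys: "distinct ys" "set ys = level k" "successively (\<lambda>x y. \<not> cocyclic x y) ys"
        "ys \<noteq> []" "generate G {hd ys [^] a} = generate G {u}"
      and w: "w \<in> carrier G" "ord w = p ^ k" "last ys = w \<otimes> s"
      using level_path[OF u(1,2) step.prems s] by blast
    have link: "\<not> cocyclic (last xs) (hd ys)" if ne: "xs \<noteq> []"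
    proof -
      have "hd ys \<in> level k" using ys(2,4) hd_in_set by auto
      then have h: "hd ys \<in> carrier G" "ord (hd ys [^] a) = p ^ k"
        using prime_support_subset by (auto simp: level_def)
      obtain i where "i \<ge> Suc k" "last xs \<in> level i" using xs(2) last_in_set[OF ne] by auto
      then have l: "last xs \<in> carrier G" "ord (last xs [^] a) = p ^ i" "k \<le> i"
        using prime_support_subset by (auto simp: level_def)
      have "hd ys [^] a \<notin> generate G {last xs [^] a}"
      proof
        assume "hd ys [^] a \<in> generate G {last xs [^] a}"
        then have "generate G {hd ys [^] a} \<subseteq> generate G {last xs [^] a}"
          using l(1) by (intro generate_singleton_mono) auto
        then have "u \<in> generate G {last xs [^] a}" using ys(5) generate.incl[of u "{u}" G] by auto
        then show False using u(3)[OF ne] by simp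
      qed
      then show ?thesis by (intro not_cocyclic_if_primary_part_not_mem[OF l(1) h(1) l(2) h(2) l(3)])
    qed
    show ?thesis
    proof (intro exI[of _ "xs @ ys"] conjI impI)
      show "distinct (xs @ ys)" using xs(1,2) ys(1,2) disj by auto
      show "set (xs @ ys) = (\<Union>i\<in>{k..}. level i)" using xs(2) ys(2) split by simp
      show "successively (\<lambda>x y. \<not> cocyclic x y) (xs @ ys)"
        using xs(3) ys(3) link by (auto simp: successively_append_iff)
      show "\<exists>w\<in>carrier G. ord w = p ^ k \<and> last (xs @ ys) = w \<otimes> s" using w ys(4) by auto
    qed
  qed
qed

lemma union_levels: "(\<Union>i\<in>{1..}. level i) = prime_support (insert p \<pi>) - prime_support \<pi>"
proof (intro equalityI subsetI)
  fix x assume "x \<in> (\<Union>i\<in>{1..}. level i)"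
  then obtain i where i: "i \<ge> 1" "x \<in> prime_support (insert p \<pi>)" "ord (x [^] a) = p ^ i"
    by (auto simp: level_def)
  then have xc: "x \<in> carrier G" using prime_support_subset by auto
  have "p ^ i > 1" using i(1) prime_gt_1_nat[OF pp] by (intro one_less_power) auto
  then have "x [^] a \<noteq> \<one>" using i(3) ord_id by auto
  then have "p dvd ord x" using primary_part_eq_one_iff[OF pp ab xc] by simp
  then show "x \<in> prime_support (insert p \<pi>) - prime_support \<pi>"
    using i(2) pA p\<pi> by (auto simp: prime_support_def)
next
  fix x assume x: "x \<in> prime_support (insert p \<pi>) - prime_support \<pi>"
  then have xc: "x \<in> carrier G" using prime_support_subset by auto
  have "p dvd ord x" using x by (auto simp: prime_support_def)
  then have ne: "x [^] a \<noteq> \<one>" using primary_part_eq_one_iff[OF pp ab xc] by simp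
  obtain i where i: "ord (x [^] a) = p ^ i" using ord_primary_part[OF pp ab xc] by auto
  have "i \<noteq> 0" using ne i ord_eq_1[of "x [^] a"] xc by auto
  then show "x \<in> (\<Union>i\<in>{1..}. level i)" using i x by (auto simp: level_def)
qed

end

text \<open>When \<open>p\<close> is added, a path through the elements with a non-trivial \<open>p\<close>-part is put in front
  of the path given by the induction hypothesis. Its last element is taken with a part \<open>s\<close> prime to
  \<open>p\<close> that is not cocyclic with the first element of the latter.\<close>

theorem hamiltonian_path:
  assumes "\<pi> \<subseteq> A"
  shows "\<exists>xs. distinct xs \<and> set xs = prime_support \<pi> - prime_support {} \<and>
    successively (\<lambda>x y. \<not> cocyclic x y) xs"
proof -
  have "finite \<pi>" using assms finite_primes by (rule finite_subset)
  then show ?thesis using assms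
  proof (induction \<pi> rule: finite_induct)
    case empty
    then show ?case by (intro exI[of _ "[]"]) simp
  next
    case (insert p \<pi>)
    have pA: "p \<in> A" using insert.prems by simp
    obtain a b where ab: "primary_exponents p a b" using primary_exponents_exist[OF prime_A[OF pA]] by auto
    obtain zs where zs: "distinct zs" "set zs = prime_support \<pi> - prime_support {}"
        "successively (\<lambda>x y. \<not> cocyclic x y) zs"
      using insert by auto
    note one = one_in_prime_support[of \<pi>]
    have "\<exists>s \<in> prime_support \<pi>. zs \<noteq> [] \<longrightarrow> \<not> cocyclic (hd zs) s"
    proof (cases "zs = []")
      case False
      then have "hd zs \<in> prime_support \<pi> - prime_support {}" using zs(2) hd_in_set by metis
      then show ?thesis using not_cocyclic_partner by blast
    qed (use one in auto)
    then obtain s where s: "s \<in> prime_support \<pi>" "zs \<noteq> [] \<Longrightarrow> \<not> cocyclic (hd zs) s" by auto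
    have "1 \<le> Suc (multiplicity p (order G))" by simp
    from upper_levels_path[OF pA insert.hyps(2) ab s(1) order_refl this]
    obtain xs where xs: "distinct xs" "set xs = prime_support (insert p \<pi>) - prime_support \<pi>"
        "successively (\<lambda>x y. \<not> cocyclic x y) xs"
        "xs \<noteq> [] \<longrightarrow> (\<exists>w \<in> carrier G. ord w = p ^ 1 \<and> last xs = w \<otimes> s)"
      unfolding union_levels[OF pA insert.hyps(2) ab] by blast
    have link: "\<not> cocyclic (last xs) (hd zs)" if ne: "xs \<noteq> []" "zs \<noteq> []"
    proof
      assume co: "cocyclic (last xs) (hd zs)"
      obtain w where w: "w \<in> carrier G" "ord w = p ^ 1" "last xs = w \<otimes> s" using xs(4) ne(1) by blast
      have "last xs [^] b = s"
        using product_in_prime_support(3)[OF pA insert.hyps(2) ab w(1,2) s(1)] w(3) by simp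
      moreover have "hd zs \<in> carrier G" using zs(2) hd_in_set[OF ne(2)] prime_support_subset by blast
      ultimately have "cocyclic s (hd zs)" using cocyclic_pow[OF co, of b 1] by simp
      then show False using s(2)[OF ne(2)] cocyclic_commute by blast
    qed
    have "prime_support {} \<subseteq> prime_support \<pi>" "prime_support \<pi> \<subseteq> prime_support (insert p \<pi>)"
      by (auto simp: prime_support_def)
    then have "distinct (xs @ zs) \<and> set (xs @ zs) = prime_support (insert p \<pi>) - prime_support {} \<and>
        successively (\<lambda>x y. \<not> cocyclic x y) (xs @ zs)"
      using xs(1-3) zs link by (auto simp: successively_append_iff)
    then show ?case by blast
  qed
qed

end

section \<open>Direct products with a cyclic group of coprime order\<close>

text \<open>The isomorphism is fixed; its two components are homomorphisms.\<close>

context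
  fixes G :: "('a, 'm) monoid_scheme" and G' :: "('b, 'k) monoid_scheme" and n :: nat
    and \<phi> :: "'a \<Rightarrow> 'b \<times> int"
  assumes grpG: "group G" and grpG': "group G'" and finG': "finite (carrier G')"
    and n: "n \<ge> 1" and coprime_n: "coprime n (order G')"
    and iso: "\<phi> \<in> iso G (G' \<times>\<times> integer_mod_group n)"
begin

interpretation G: group G by (rule grpG)
interpretation G': group G' by (rule grpG')
interpretation Zn: comm_group "integer_mod_group n" by (rule abelian_integer_mod_group)

lemma \<phi>_bij: "bij_betw \<phi> (carrier G) (carrier G' \<times> carrier (integer_mod_group n))"
  using iso by (auto simp: iso_def)

lemma \<phi>_closed:
  assumes "x \<in> carrier G"
  shows "fst (\<phi> x) \<in> carrier G'" "snd (\<phi> x) \<in> carrier (integer_mod_group n)"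
  using bij_betwE[OF \<phi>_bij] assms by (auto simp: mem_Times_iff)

lemma \<phi>_eqI:
  assumes "x \<in> carrier G" "y \<in> carrier G" "fst (\<phi> x) = fst (\<phi> y)" "snd (\<phi> x) = snd (\<phi> y)"
  shows "x = y"
  using \<phi>_bij assms by (metis bij_betw_def inj_onD prod.expand)

lemma \<phi>_mult:
  assumes "x \<in> carrier G" "y \<in> carrier G"
  shows "\<phi> (x \<otimes>\<^bsub>G\<^esub> y)
    = (fst (\<phi> x) \<otimes>\<^bsub>G'\<^esub> fst (\<phi> y), snd (\<phi> x) \<otimes>\<^bsub>integer_mod_group n\<^esub> snd (\<phi> y))"
proof -
  have "\<phi> (x \<otimes>\<^bsub>G\<^esub> y) = \<phi> x \<otimes>\<^bsub>G' \<times>\<times> integer_mod_group n\<^esub> \<phi> y"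
    using iso assms by (auto simp: iso_def hom_def)
  then show ?thesis by (cases "\<phi> x"; cases "\<phi> y") simp
qed

interpretation f: group_hom G G' "\<lambda>x. fst (\<phi> x)"
  by unfold_locales (auto simp: hom_def \<phi>_closed \<phi>_mult)

interpretation g: group_hom G "integer_mod_group n" "\<lambda>x. snd (\<phi> x)"
  by unfold_locales (auto simp: hom_def \<phi>_closed \<phi>_mult simp del: mult_integer_mod_group)

lemma \<phi>_surj:
  assumes "a \<in> carrier G'" "b \<in> carrier (integer_mod_group n)"
  obtains x where "x \<in> carrier G" "fst (\<phi> x) = a" "snd (\<phi> x) = b"
proof -
  have "(a, b) \<in> \<phi> ` carrier G" using \<phi>_bij assms by (simp add: bij_betw_def)
  then obtain x where "x \<in> carrier G" "\<phi> x = (a, b)" by (metis imageE)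
  then show ?thesis by (intro that[of x]) simp_all
qed

lemma finite_carrier_product: "finite (carrier G)"
proof -
  have "finite (carrier (integer_mod_group n))" using n by (simp add: carrier_integer_mod_group)
  then show ?thesis using \<phi>_bij finG' bij_betw_finite by blast
qed

lemma pow_component:
  assumes "x \<in> carrier G"
  shows "fst (\<phi> (x [^]\<^bsub>G\<^esub> k)) = fst (\<phi> x) [^]\<^bsub>G'\<^esub> (k::nat)"
    and "snd (\<phi> (x [^]\<^bsub>G\<^esub> k)) = (int k * snd (\<phi> x)) mod int n"
  using f.hom_nat_pow[OF assms, of k] g.hom_nat_pow[OF assms, of k] by simp_all

lemma ord_component_dvd:
  assumes "x \<in> carrier G"
  shows "G'.ord (fst (\<phi> x)) dvd G.ord x"
proof -
  have "fst (\<phi> x) [^]\<^bsub>G'\<^esub> G.ord x = \<one>\<^bsub>G'\<^esub>"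
    using pow_component(1)[OF assms, of "G.ord x"] f.hom_one assms by simp
  then show ?thesis using G'.pow_eq_id[OF \<phi>_closed(1)[OF assms]] by simp
qed

lemma ord_eq_component:
  assumes x: "x \<in> carrier G" and s: "snd (\<phi> x) = 0"
  shows "G.ord x = G'.ord (fst (\<phi> x))"
proof (rule dvd_antisym)
  let ?k = "G'.ord (fst (\<phi> x))"
  have "x [^]\<^bsub>G\<^esub> ?k = \<one>\<^bsub>G\<^esub>"
  proof (rule \<phi>_eqI)
    show "fst (\<phi> (x [^]\<^bsub>G\<^esub> ?k)) = fst (\<phi> \<one>\<^bsub>G\<^esub>)"
      using pow_component(1)[OF x] \<phi>_closed(1)[OF x] f.hom_one by simp
    show "snd (\<phi> (x [^]\<^bsub>G\<^esub> ?k)) = snd (\<phi> \<one>\<^bsub>G\<^esub>)"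
      using pow_component(2)[OF x] s g.hom_one by simp
  qed (use x in auto)
  then show "G.ord x dvd ?k" using G.pow_eq_id[OF x] by simp
qed (rule ord_component_dvd[OF x])

lemma cyclic_component_eq_zero:
  assumes x: "x \<in> carrier G" and cop: "coprime (G.ord x) n"
  shows "snd (\<phi> x) = 0"
proof -
  have s: "snd (\<phi> x) \<in> carrier (integer_mod_group n)" by (rule \<phi>_closed(2)[OF x])
  have "(int (G.ord x) * snd (\<phi> x)) mod int n = 0"
    using pow_component(2)[OF x, of "G.ord x"] g.hom_one x by simp
  then have "int n dvd int (G.ord x) * snd (\<phi> x)" by (simp add: mod_eq_0_iff_dvd)
  then have "int n dvd snd (\<phi> x)"
    using cop by (metis coprime_commute coprime_dvd_mult_right_iff coprime_int_iff)
  then show ?thesis using s n by (auto simp: carrier_integer_mod_group zdvd_not_zless dest: zdvd_imp_le)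
qed

lemma component_eq_one:
  assumes x: "x \<in> carrier G" and cop: "coprime (G.ord x) (order G')"
  shows "fst (\<phi> x) = \<one>\<^bsub>G'\<^esub>"
proof -
  have "is_unit (G'.ord (fst (\<phi> x)))"
    using coprime_common_divisor[OF cop] ord_component_dvd[OF x]
      G'.ord_dvd_group_order[OF \<phi>_closed(1)[OF x]] by blast
  then show ?thesis using G'.ord_eq_1[OF \<phi>_closed(1)[OF x]] by simp
qed

text \<open>If \<open>y\<close> corresponds to \<open>(c, d)\<close>, the element \<open>z\<close> corresponding to \<open>(c, 1)\<close> generates
  a subgroup that contains \<open>y\<close> and, by the Chinese remainder theorem, every \<open>x\<close> with trivial first
  component. The second component of \<open>z\<close> is written \<open>1 mod n\<close> to cover \<open>n = 1\<close>.\<close>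

lemma central_component_cocyclic:
  assumes x: "x \<in> carrier G" "fst (\<phi> x) = \<one>\<^bsub>G'\<^esub>" and y: "y \<in> carrier G"
  shows "G.cocyclic x y"
proof -
  have "1 mod int n \<in> carrier (integer_mod_group n)" using n by (simp add: carrier_integer_mod_group)
  then obtain z where z: "z \<in> carrier G" "fst (\<phi> z) = fst (\<phi> y)" "snd (\<phi> z) = 1 mod int n"
    using \<phi>_surj \<phi>_closed(1)[OF y] by metis
  have pow: "\<exists>i::nat. v = z [^]\<^bsub>G\<^esub> i"
    if v: "v \<in> carrier G" and t: "fst (\<phi> v) = fst (\<phi> y) [^]\<^bsub>G'\<^esub> (t::nat)" for v t
  proof -
    have sv: "0 \<le> snd (\<phi> v)" "snd (\<phi> v) < int n"
      using \<phi>_closed(2)[OF v] n by (auto simp: carrier_integer_mod_group)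
    have "coprime (order G') n" using coprime_n by (simp add: coprime_commute)
    then obtain i where i: "[i = t] (mod order G')" "[i = nat (snd (\<phi> v))] (mod n)"
      using binary_chinese_remainder_nat by blast
    have "[i = t] (mod G'.ord (fst (\<phi> y)))"
      using i(1) G'.ord_dvd_group_order[OF \<phi>_closed(1)[OF y]] cong_dvd_modulus_nat by blast
    then have "fst (\<phi> (z [^]\<^bsub>G\<^esub> i)) = fst (\<phi> v)"
      using G'.pow_eq_of_cong[OF \<phi>_closed(1)[OF y]] pow_component(1)[OF z(1)] z(2) t by simp
    moreover have "snd (\<phi> (z [^]\<^bsub>G\<^esub> i)) = snd (\<phi> v)"
    proof -
      have "snd (\<phi> (z [^]\<^bsub>G\<^esub> i)) = int i mod int n"
        using pow_component(2)[OF z(1)] z(3) by (simp add: mod_mult_right_eq)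
      also have "\<dots> = int (nat (snd (\<phi> v))) mod int n"
        using i(2) by (metis cong_def cong_int_iff)
      also have "\<dots> = snd (\<phi> v)" using sv by simp
      finally show ?thesis .
    qed
    ultimately have "v = z [^]\<^bsub>G\<^esub> i" using v z(1) by (intro \<phi>_eqI) auto
    then show ?thesis ..
  qed
  have "\<exists>i::nat. x = z [^]\<^bsub>G\<^esub> i" using pow[OF x(1), of 0] x(2) by simp
  moreover have "\<exists>i::nat. y = z [^]\<^bsub>G\<^esub> i" using pow[OF y, of 1] \<phi>_closed(1)[OF y] by simp
  ultimately show ?thesis
    using z(1) G.generate_singleton_iff[OF finite_carrier_product z(1)] by (auto simp: G.cocyclic_def)
qed

lemma primary_noncyclic_group_product:
  assumes nil: "nilpotent_group G'" and odd: "odd (order G')"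
    and noncyc: "\<And>p P. Factorial_Ring.prime p \<Longrightarrow> p dvd order G' \<Longrightarrow> sylow_subgroup G' p P \<Longrightarrow>
           \<not> cyclic_group (G'\<lparr>carrier := P\<rparr>)"
  shows "primary_noncyclic_group G {p. Factorial_Ring.prime p \<and> p dvd order G'}"
proof unfold_locales
  show "finite (carrier G)" by (rule finite_carrier_product)
  have "order G' > 0" using finG' by (simp add: G'.order_gt_0_iff_finite)
  then show "finite {p. Factorial_Ring.prime p \<and> p dvd order G'}"
    by (intro finite_prime_divisors) simp
  fix p assume "p \<in> {p. Factorial_Ring.prime p \<and> p dvd order G'}"
  then have p: "Factorial_Ring.prime p" "p dvd order G'" by auto
  show "Factorial_Ring.prime p" by (rule p(1))
  have pn: "\<not> p dvd n"
    using p coprime_n by (metis coprime_common_divisor not_prime_unit)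
  fix x k assume x: "x \<in> carrier G" and ordx: "G.ord x = p ^ k"
  have "coprime (G.ord x) n" using pn p(1) ordx by (simp add: prime_imp_coprime)
  then have sx: "snd (\<phi> x) = 0" by (rule cyclic_component_eq_zero[OF x])
  have fx: "G'.ord (fst (\<phi> x)) = p ^ k" using ord_eq_component[OF x sx] ordx by simp
  show "x \<otimes>\<^bsub>G\<^esub> y = y \<otimes>\<^bsub>G\<^esub> x" if y: "y \<in> carrier G" and ordy: "\<not> p dvd G.ord y" for y
  proof (rule \<phi>_eqI)
    have "coprime (p ^ k) (G.ord y)" using ordy p(1) by (simp add: prime_imp_coprime)
    then have "coprime (G'.ord (fst (\<phi> x))) (G'.ord (fst (\<phi> y)))"
      using ord_component_dvd[OF y] fx by (metis coprime_divisors dvd_refl)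
    then show "fst (\<phi> (x \<otimes>\<^bsub>G\<^esub> y)) = fst (\<phi> (y \<otimes>\<^bsub>G\<^esub> x))"
      using G'.nilpotent_coprime_commute[OF nil \<phi>_closed(1)[OF x] \<phi>_closed(1)[OF y]]
      by (simp add: \<phi>_mult x y)
    show "snd (\<phi> (x \<otimes>\<^bsub>G\<^esub> y)) = snd (\<phi> (y \<otimes>\<^bsub>G\<^esub> x))"
      by (simp add: \<phi>_mult x y add.commute)
  qed (use x y in auto)
  show "\<exists>w\<in>carrier G. G.ord w = p ^ k \<and> w \<notin> generate G {x}" if k: "1 \<le> k"
  proof -
    have "odd p" using p(2) odd dvd_trans by blast
    then obtain v where v: "v \<in> carrier G'" "G'.ord v = p ^ k" "v \<notin> generate G' {fst (\<phi> x)}"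
      using G'.odd_noncyclic_second_primary[OF finG' nil p(1) _ noncyc[OF p] \<phi>_closed(1)[OF x] fx k]
      by blast
    obtain w where w: "w \<in> carrier G" "fst (\<phi> w) = v" "snd (\<phi> w) = 0"
      using \<phi>_surj[OF v(1) integer_mod_group_0] by metis
    have "w \<notin> generate G {x}"
    proof
      assume "w \<in> generate G {x}"
      then obtain i where "w = x [^]\<^bsub>G\<^esub> (i::nat)"
        using G.generate_singleton_iff[OF finite_carrier_product x] by auto
      then have "v = fst (\<phi> x) [^]\<^bsub>G'\<^esub> i" using pow_component(1)[OF x] w(2) by simp
      then show False
        using v(3) G'.generate_singleton_iff[OF finG' \<phi>_closed(1)[OF x]] by blast
    qed
    then show ?thesis using w v(2) ord_eq_component[OF w(1,3)] by auto
  qed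
qed

lemma dominating_vertices_product:
  assumes "primary_noncyclic_group G A" and A: "A = {p. Factorial_Ring.prime p \<and> p dvd order G'}"
  shows "dominating_vertices (enhanced_power_graph G) = primary_noncyclic_group.prime_support G A {}"
    and "x \<in> dominating_vertices (enhanced_power_graph G) \<longleftrightarrow> x \<in> carrier G \<and> fst (\<phi> x) = \<one>\<^bsub>G'\<^esub>"
proof -
  interpret P: primary_noncyclic_group G A by fact
  let ?D = "dominating_vertices (enhanced_power_graph G)"
  have cent: "fst (\<phi> x) = \<one>\<^bsub>G'\<^esub>" if x: "x \<in> P.prime_support {}" for x
  proof (rule component_eq_one)
    show "x \<in> carrier G" using x by (simp add: P.prime_support_def)
    show "coprime (G.ord x) (order G')"
    proof (rule ccontr)
      assume "\<not> coprime (G.ord x) (order G')"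
      then have "gcd (G.ord x) (order G') \<noteq> 1" by (simp add: coprime_iff_gcd_eq_1)
      then obtain q where "Factorial_Ring.prime q" "q dvd gcd (G.ord x) (order G')"
        using prime_factor_nat by blast
      then have "q \<in> A" "q dvd G.ord x" by (simp_all add: A)
      then show False using x by (auto simp: P.prime_support_def)
    qed
  qed
  have dom: "x \<in> ?D" if x: "x \<in> carrier G" "fst (\<phi> x) = \<one>\<^bsub>G'\<^esub>" for x
    using x central_component_cocyclic[OF x]
    by (auto simp: dominating_vertices_def enhanced_power_graph_def G.cocyclic_def)
  have supp: "x \<in> P.prime_support {}" if x: "x \<in> ?D" for x
  proof (rule ccontr)
    assume "x \<notin> P.prime_support {}"
    moreover have xc: "x \<in> carrier G"
      using x by (simp add: dominating_vertices_def enhanced_power_graph_def)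
    ultimately obtain s where s: "s \<in> P.prime_support A" "\<not> G.cocyclic x s"
      using P.not_cocyclic_partner[of x A] by (auto simp: P.prime_support_def)
    have "G.cocyclic x x" using xc by (auto simp: G.cocyclic_def intro: generate.incl)
    then have "s \<noteq> x" using s(2) by auto
    moreover have "s \<in> carrier G" using s(1) by (simp add: P.prime_support_def)
    ultimately have "(x, s) \<in> parcs (enhanced_power_graph G)"
      using x by (simp add: dominating_vertices_def enhanced_power_graph_def)
    then show False using s(2) by (auto simp: enhanced_power_graph_def G.cocyclic_def)
  qed
  show "?D = P.prime_support {}"
    using cent dom supp P.prime_support_subset by blast
  show "x \<in> ?D \<longleftrightarrow> x \<in> carrier G \<and> fst (\<phi> x) = \<one>\<^bsub>G'\<^esub>"
    using cent dom supp P.prime_support_subset by blast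
qed

lemma lambda_number_product:
  assumes nontriv: "\<not> trivial_group G'" and prim: "primary_noncyclic_group G {p. Factorial_Ring.prime p \<and> p dvd order G'}"
  shows "lambda_number (enhanced_power_graph G) =
           order G + card (dominating_vertices (enhanced_power_graph G)) - 1"
proof -
  let ?\<Gamma> = "enhanced_power_graph G" and ?A = "{p. Factorial_Ring.prime p \<and> p dvd order G'}"
  interpret P: primary_noncyclic_group G ?A by (rule prim)
  note dom = dominating_vertices_product[OF prim refl]
  have supp: "P.prime_support ?A = carrier G" by (auto simp: P.prime_support_def)
  obtain xs where xs: "distinct xs" "set xs = carrier G - dominating_vertices ?\<Gamma>"
      "successively (\<lambda>x y. \<not> G.cocyclic x y) xs"
    using P.hamiltonian_path[OF order_refl] unfolding supp dom(1) by blast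
  obtain c where c: "c \<in> carrier G'" "c \<noteq> \<one>\<^bsub>G'\<^esub>"
    using nontriv G'.trivial_group_subset by blast
  obtain x where x: "x \<in> carrier G" "fst (\<phi> x) = c"
    using \<phi>_surj[OF c(1) integer_mod_group_0] by metis
  then have "x \<in> set xs" using xs(2) dom(2)[of x] c(2) by simp
  then have ne: "xs \<noteq> []" by auto
  have "dominating_vertices ?\<Gamma> \<noteq> {}" using P.one_in_prime_support dom(1) by auto
  moreover have "successively (\<lambda>u v. (u, v) \<notin> parcs ?\<Gamma>) xs"
    using xs(3) by (rule successively_mono) (auto simp: enhanced_power_graph_def G.cocyclic_def)
  moreover have "pverts ?\<Gamma> = carrier G" by (simp add: enhanced_power_graph_def)
  ultimately show ?thesis
    using lambda_number_eq_of_path[OF pair_graph_enhanced_power_graph[OF P.finite_carrier] _ ne xs(1)] xs(2)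
    by (simp add: order_def)
qed

end

theorem theorem3p9:
  fixes G :: "('a, 'm) monoid_scheme" and G' :: "('b, 'k) monoid_scheme" and n :: nat
  assumes "group G'" and "finite (carrier G')"
    and "\<not> trivial_group G'"
    and "nilpotent_group G'"
    and "odd (order G')"
    and "\<And>p P. Factorial_Ring.prime p \<Longrightarrow> p dvd order G' \<Longrightarrow> sylow_subgroup G' p P \<Longrightarrow>
           \<not> cyclic_group (G'\<lparr>carrier := P\<rparr>)"
    and "n \<ge> 1" and "coprime n (order G')"
    and "group G" and "G \<cong> G' \<times>\<times> integer_mod_group n"
  shows "lambda_number (enhanced_power_graph G) =
           order G + card (dominating_vertices (enhanced_power_graph G)) - 1"
proof -
  obtain \<phi> where \<phi>: "\<phi> \<in> iso G (G' \<times>\<times> integer_mod_group n)"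
    using assms(10) by (auto simp: is_iso_def)
  note setting = assms(9,1,2,7,8) \<phi>
  show ?thesis
    by (rule lambda_number_product[OF setting assms(3)
          primary_noncyclic_group_product[OF setting assms(4,5,6)]])
qed

end
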